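(* Let $s\in(\tfrac12,1)$, $b\in(0,1)$, $\sigma_1>0>\sigma_2$, $\sigma_3=0$, and fix $\psi^s\in\widetilde H^s(I)$ with $\psi^s(b)=1$. Let $\Phi_1,\Phi_2>0$ be as defined in the context, and assume $\dfrac{|\sigma_2|}{\sigma_1}\neq\dfrac{\Phi_1}{\Phi_2}$. Set $\varepsilon=\operatorname{sign}\big(1-\frac{|\sigma_2|}{\sigma_1}\frac{\Phi_2}{\Phi_1}\big)\in\{-1,1\}$ and define, for $v\in\widetilde H^s(I)$ written as $v=v_0+v(b)\psi^s$ with $v_0(b)=0$, $$Tv=v_0+\varepsilon v(b)\psi^s\ \text{on } I_1,\qquad Tv=-v_0+\varepsilon v(b)\psi^s\ \text{on } I_2.$$ Then $T\in\mathcal L(\widetilde H^s(I))$ is bijective, and there exist a compact operator $K\in\mathcal K(\widetilde H^s(I))$ and constants $\alpha,\beta>0$ such that $$|a^s_{\underline\sigma}(v,Tv)|\ge\alpha\|v\|^2_{\widetilde H^s(I)}-\beta\|Kv\|^2_{\widetilde H^s(I)}\qquad\forall v\in\widetilde H^s(I),$$ i.e. $a^s_{\underline\sigma}$ is weakly T-coercive. Consequently, the operator $A^s:\widetilde H^s(I)\to H^{-s}(I)$, $\langle A^su,v\rangle=a^s_{\underline\sigma}(u,v)$, is Fredholm of index zero, so the problem "find $u\in\widetilde H^s(I)$ with $a^s_{\underline\sigma}(u,v)=\langle f,v\rangle$ for all $v\in\widetilde H^s(I)$", $f\in H^{-s}(I)$, is well posed in the Fredholm sense.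
   Context: $I=(0,1)$, $I_1=(0,b)$, $I_2=(b,1)$. For $s\in(0,1)$, $C(s)=\dfrac{2^{2s}s\,\Gamma(s+\frac12)}{\sqrt\pi\,\Gamma(1-s)}$. $\widetilde H^s(I)$ is the space of functions $w$ on $I$ whose extension $\widetilde w$ by zero lies in $H^s(\mathbb R)$, with norm $\|w\|^2_{\widetilde H^s(I)}=\frac{C(s)}2\iint_{\mathbb R^2}\frac{|\widetilde w(x)-\widetilde w(y)|^2}{|x-y|^{1+2s}}\,\mathrm dy\,\mathrm dx$; $H^{-s}(I)$ is its dual. For $s>\frac12$ its elements are continuous. The coefficient $\underline\sigma(x,y)$ is symmetric ($\underline\sigma(x,y)=\underline\sigma(y,x)$) with $\underline\sigma=\sigma_1$ on $I_1\times(I_1\cup(\mathbb R\setminus I))$, $\underline\sigma=\sigma_2$ on $I_2\times(I_2\cup(\mathbb R\setminus I))$, $\underline\sigma=\sigma_3$ on $I_1\times I_2$. The form is $a^s_{\underline\sigma}(u,v)=\frac{C(s)}2\iint_{\mathbb R^2}\underline\sigma(x,y)\frac{(\widetilde u(x)-\widetilde u(y))(\widetilde v(x)-\widetilde v(y))}{|x-y|^{1+2s}}\,\mathrm dy\,\mathrm dx$. With $|w|^2_{H^s(I_i)}=\frac{C(s)}2\int_{I_i}\int_{I_i}\frac{|w(x)-w(y)|^2}{|x-y|^{1+2s}}\mathrm dy\,\mathrm dx$ and $\omega(x)=\int_{\mathbb R\setminus I}\frac{\mathrm dy}{|x-y|^{1+2s}}$, define $\Phi_i=\frac{2}{C(s)}|\psi^s|^2_{H^s(I_i)}+2\int_{I_i}|\psi^s(x)|^2\omega(x)\,\mathrm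 dx$ for $i=1,2$. *)

theory Defs
  imports "HOL-Analysis.Analysis"
begin

definition I0 :: "real set" where "I0 = {0<..<1}"
definition I1 :: "real \<Rightarrow> real set" where "I1 b = {0<..<b}"
definition I2 :: "real \<Rightarrow> real set" where "I2 b = {b<..<1}"

definition Cs :: "real \<Rightarrow> real" where
  "Cs s = (2::real) powr (2 * s) * s * Gamma (s + 1/2) / (sqrt pi * Gamma (1 - s))"

definition kern :: "real \<Rightarrow> real \<Rightarrow> real \<Rightarrow> real" where
  "kern s x y = 1 / \<bar>x - y\<bar> powr (1 + 2 * s)"

text \<open>Gagliardo double integral over R x R of the (already zero-extended) function w
  (nonnegative integral, used to express finiteness).\<close>
definition gag_nn :: "real \<Rightarrow> (real \<Rightarrow> real) \<Rightarrow> ennreal" where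
  "gag_nn s w = (\<integral>\<^sup>+ p. ennreal ((w (fst p) - w (snd p))^2 * kern s (fst p) (snd p)) \<partial>(lborel \<Otimes>\<^sub>M lborel))"

text \<open>The space \<open>\<widetilde>H^s(I)\<close> for s > 1/2: its elements are identified with their
  (unique) continuous representatives, extended by zero outside I.\<close>
definition Htilde :: "real \<Rightarrow> (real \<Rightarrow> real) set" where
  "Htilde s = {w. continuous_on UNIV w \<and> (\<forall>x. x \<notin> I0 \<longrightarrow> w x = 0) \<and> gag_nn s w < \<infinity>}"

definition Hnorm2 :: "real \<Rightarrow> (real \<Rightarrow> real) \<Rightarrow> real" where
  "Hnorm2 s w = Cs s / 2 *
     (\<integral>p. (w (fst p) - w (snd p))^2 * kern s (fst p) (snd p) \<partial>(lborel \<Otimes>\<^sub>M lborel))"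

definition Hnorm :: "real \<Rightarrow> (real \<Rightarrow> real) \<Rightarrow> real" where
  "Hnorm s w = sqrt (Hnorm2 s w)"

text \<open>The piecewise constant symmetric coefficient sigma(x,y).  On sets of measure zero
  (both points outside I, or points equal to 0, b, 1) the value is irrelevant; we put 0.\<close>
definition sigma_coef :: "real \<Rightarrow> real \<Rightarrow> real \<Rightarrow> real \<Rightarrow> real \<Rightarrow> real \<Rightarrow> real" where
  "sigma_coef b \<sigma>1 \<sigma>2 \<sigma>3 x y =
     (if (x \<in> I1 b \<and> (y \<in> I1 b \<or> y \<notin> I0)) \<or> (y \<in> I1 b \<and> x \<notin> I0) then \<sigma>1
      else if (x \<in> I2 b \<and> (y \<in> I2 b \<or> y \<notin> I0)) \<or> (y \<in> I2 b \<and> x \<notin> I0) then \<sigma>2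
      else if (x \<in> I1 b \<and> y \<in> I2 b) \<or> (x \<in> I2 b \<and> y \<in> I1 b) then \<sigma>3
      else 0)"

definition aform :: "real \<Rightarrow> (real \<Rightarrow> real \<Rightarrow> real) \<Rightarrow> (real \<Rightarrow> real) \<Rightarrow> (real \<Rightarrow> real) \<Rightarrow> real" where
  "aform s \<sigma> u v = Cs s / 2 *
     (\<integral>p. \<sigma> (fst p) (snd p) * (u (fst p) - u (snd p)) * (v (fst p) - v (snd p))
            * kern s (fst p) (snd p) \<partial>(lborel \<Otimes>\<^sub>M lborel))"

definition semi2 :: "real \<Rightarrow> real set \<Rightarrow> (real \<Rightarrow> real) \<Rightarrow> real" where
  "semi2 s J w = Cs s / 2 *
     (\<integral>p. indicator (J \<times> J) p * (w (fst p) - w (snd p))^2 * kern s (fst p) (snd p)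
        \<partial>(lborel \<Otimes>\<^sub>M lborel))"

definition omega :: "real \<Rightarrow> real \<Rightarrow> real" where
  "omega s x = (LINT y : (- I0) | lborel. kern s x y)"

definition Phi :: "real \<Rightarrow> real set \<Rightarrow> (real \<Rightarrow> real) \<Rightarrow> real" where
  "Phi s J \<psi> = 2 / Cs s * semi2 s J \<psi> + 2 * (LINT x : J | lborel. (\<psi> x)^2 * omega s x)"

definition Top :: "real \<Rightarrow> real \<Rightarrow> (real \<Rightarrow> real) \<Rightarrow> (real \<Rightarrow> real) \<Rightarrow> (real \<Rightarrow> real)" where
  "Top b \<epsilon> \<psi> v = (\<lambda>x. (if x \<in> I1 b then 1 else if x \<in> I2 b then -1 else 0) * (v x - v b * \<psi> x)
                       + \<epsilon> * v b * \<psi> x)"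

definition lin_on :: "(real \<Rightarrow> real) set \<Rightarrow> ((real \<Rightarrow> real) \<Rightarrow> (real \<Rightarrow> real)) \<Rightarrow> bool" where
  "lin_on H L \<longleftrightarrow> (\<forall>u\<in>H. \<forall>v\<in>H. \<forall>c::real.
      L (\<lambda>x. u x + v x) = (\<lambda>x. L u x + L v x) \<and> L (\<lambda>x. c * u x) = (\<lambda>x. c * L u x))"

definition bounded_op :: "real \<Rightarrow> ((real \<Rightarrow> real) \<Rightarrow> (real \<Rightarrow> real)) \<Rightarrow> bool" where
  "bounded_op s L \<longleftrightarrow> (\<forall>v\<in>Htilde s. L v \<in> Htilde s) \<and> lin_on (Htilde s) L \<and>
     (\<exists>C. \<forall>v\<in>Htilde s. Hnorm s (L v) \<le> C * Hnorm s v)"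

definition compact_op :: "real \<Rightarrow> ((real \<Rightarrow> real) \<Rightarrow> (real \<Rightarrow> real)) \<Rightarrow> bool" where
  "compact_op s K \<longleftrightarrow> bounded_op s K \<and>
     (\<forall>v::nat \<Rightarrow> real \<Rightarrow> real. (\<forall>n. v n \<in> Htilde s) \<and> (\<exists>M. \<forall>n. Hnorm s (v n) \<le> M) \<longrightarrow>
        (\<exists>r w. strict_mono r \<and> w \<in> Htilde s \<and>
           (\<lambda>n. Hnorm s (\<lambda>x. K (v (r n)) x - w x)) \<longlonglongrightarrow> 0))"

definition Hdual :: "real \<Rightarrow> ((real \<Rightarrow> real) \<Rightarrow> real) set" where
  "Hdual s = {f. (\<forall>v. v \<notin> Htilde s \<longrightarrow> f v = 0) \<and>
     (\<forall>u\<in>Htilde s. \<forall>v\<in>Htilde s. \<forall>c::real.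
        f (\<lambda>x. u x + v x) = f u + f v \<and> f (\<lambda>x. c * u x) = c * f u) \<and>
     (\<exists>C. \<forall>v\<in>Htilde s. \<bar>f v\<bar> \<le> C * Hnorm s v)}"

definition dual_norm :: "real \<Rightarrow> ((real \<Rightarrow> real) \<Rightarrow> real) \<Rightarrow> real" where
  "dual_norm s f = (SUP v\<in>Htilde s - {\<lambda>x. 0}. \<bar>f v\<bar> / Hnorm s v)"

definition Aop :: "real \<Rightarrow> (real \<Rightarrow> real \<Rightarrow> real) \<Rightarrow> (real \<Rightarrow> real) \<Rightarrow> ((real \<Rightarrow> real) \<Rightarrow> real)" where
  "Aop s \<sigma> u = (\<lambda>v. if v \<in> Htilde s then aform s \<sigma> u v else 0)"

definition fredholm_index_zero :: "real \<Rightarrow> ((real \<Rightarrow> real) \<Rightarrow> ((real \<Rightarrow> real) \<Rightarrow> real)) \<Rightarrow> bool" where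
  "fredholm_index_zero s A \<longleftrightarrow>
     (let H = Htilde s; Ker = {u\<in>H. A u = (\<lambda>v. 0)}; R = A ` H in
      (\<forall>u\<in>H. A u \<in> Hdual s) \<and>
      (\<forall>u\<in>H. \<forall>w\<in>H. \<forall>c::real.
         A (\<lambda>x. u x + w x) = (\<lambda>v. A u v + A w v) \<and> A (\<lambda>x. c * u x) = (\<lambda>v. c * A u v)) \<and>
      (\<exists>C. \<forall>u\<in>H. dual_norm s (A u) \<le> C * Hnorm s u) \<and>
      (\<forall>f g. (\<forall>n. f n \<in> R) \<and> g \<in> Hdual s \<and> (\<lambda>n. dual_norm s (\<lambda>v. f n v - g v)) \<longlonglongrightarrow> 0
              \<longrightarrow> g \<in> R) \<and>
      (\<exists>n::nat.
         (\<exists>e::nat \<Rightarrow> real \<Rightarrow> real.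
            (\<forall>i<n. e i \<in> Ker) \<and>
            (\<forall>c. (\<lambda>x. \<Sum>i<n. c i * e i x) = (\<lambda>x. 0) \<longrightarrow> (\<forall>i<n. c i = 0)) \<and>
            (\<forall>u\<in>Ker. \<exists>c. u = (\<lambda>x. \<Sum>i<n. c i * e i x))) \<and>
         (\<exists>g::nat \<Rightarrow> (real \<Rightarrow> real) \<Rightarrow> real.
            (\<forall>i<n. g i \<in> Hdual s) \<and>
            (\<forall>c. (\<lambda>v. \<Sum>i<n. c i * g i v) \<in> R \<longrightarrow> (\<forall>i<n. c i = 0)) \<and>
            (\<forall>f\<in>Hdual s. \<exists>c. \<exists>r\<in>R. f = (\<lambda>v. r v + (\<Sum>i<n. c i * g i v))))))"

end

theory Submission
  imports Defs
begin

text \<open>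
  On functions vanishing at \<open>b\<close> the reflection \<open>v \<mapsto> v\<close> on \<open>I1\<close>, \<open>v \<mapsto> -v\<close> on \<open>I2\<close> turns the
  sign-changing form (with vanishing cross coefficient) into the positive one with coefficients
  \<open>\<sigma>1\<close>, \<open>\<bar>\<sigma>2\<bar>\<close>. The fractional Hardy inequality with weight \<open>\<bar>x - b\<bar> powr (-2 * s)\<close>, valid for
  \<open>s > 1/2\<close>, controls the missing interaction between \<open>I1\<close> and \<open>I2\<close>; hence the reflection is
  bounded and the positive form is equivalent to the squared norm on \<open>{v. v b = 0}\<close>. All
  remaining terms carry a factor \<open>v b\<close>, so \<open>K v = v b * \<psi>\<close>, of rank one, absorbs them.

  The Riesz representation theorem for the positive form on \<open>{v. v b = 0}\<close> gives a unique \<open>k\<close> with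
  \<open>k b = 1\<close> that the form pairs to zero with this hyperplane. With \<open>D\<close> the value of the form at
  \<open>(k, k)\<close>, the operator is bijective if \<open>D \<noteq> 0\<close>; otherwise its kernel is spanned by \<open>k\<close> and its
  range consists of the functionals vanishing at \<open>k\<close>.
\<close>

section \<open>A fractional Hardy inequality\<close>

text \<open>The norm integrates over pairs on opposite sides of \<open>b\<close>, while the form
  gives such pairs inside \<open>I\<close> the weight 0, so the integrands cannot be compared
  pointwise. Estimating \<open>(w x - w y)^2\<close> by \<open>2 * (w x)^2 + 2 * (w y)^2\<close>
  across \<open>b\<close> and integrating out the far variable leaves the weight
  \<open>\<bar>x - b\<bar> powr (-2 * s)\<close>, too singular for functions that do not vanish at
  \<open>b\<close>; hence the part \<open>v b * \<psi>\<close> is split off. The bound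
  \<open>s > 1/2\<close> makes shrinking the argument a contraction in the weighted norm, and it
  makes evaluation at \<open>b\<close> bounded, so that the hyperplane is closed. The Fredholm
  property is not deduced from the T-coercivity estimate: the problem restricted to
  \<open>{v. v b = 0}\<close>, of codimension 1, is uniquely solvable, and what remains is one
  scalar equation with coefficient \<open>D\<close>, a Schur complement. The space is a plain set of
  functions, so completeness and the Riesz theorem are proved for it directly.\<close>

lemma square_sum_le_geometric:
  fixes d :: "nat \<Rightarrow> real"
  assumes q: "0 < q" "q < 1"
  shows "(\<Sum>k<n. d k)\<^sup>2 \<le> (\<Sum>k<n. (d k)\<^sup>2 / q ^ k) / (1 - q)"
proof -
  \<comment> \<open>Cauchy-Schwarz with weights \<open>q ^ k\<close> stands in for Minkowski's
    inequality in a weighted \<open>L^2\<close>. The price \<open>1 / q ^ k\<close> on the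
    \<open>k\<close>-th term is affordable because the dilation by \<open>t ^ k\<close> later
    contributes \<open>q ^ (2 * k)\<close>.\<close>
  have "(\<Sum>k<n. d k)\<^sup>2 = (\<Sum>k<n. sqrt (q ^ k) * (d k / sqrt (q ^ k)))\<^sup>2"
    using q by simp
  also have "\<dots> \<le> (\<Sum>k<n. (sqrt (q ^ k))\<^sup>2) * (\<Sum>k<n. (d k / sqrt (q ^ k))\<^sup>2)"
    by (rule Cauchy_Schwarz_ineq_sum)
  also have "\<dots> = (\<Sum>k<n. q ^ k) * (\<Sum>k<n. (d k)\<^sup>2 / q ^ k)"
    using q by (simp add: power_divide)
  also have "\<dots> \<le> (1 / (1 - q)) * (\<Sum>k<n. (d k)\<^sup>2 / q ^ k)"
  proof (rule mult_right_mono)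
    have "(\<Sum>k<n. q ^ k) = (1 - q ^ n) / (1 - q)"
      using q by (simp add: sum_gp_strict)
    also have "\<dots> \<le> 1 / (1 - q)"
      using q by (intro divide_right_mono) auto
    finally show "(\<Sum>k<n. q ^ k) \<le> 1 / (1 - q)" .
  qed (use q in \<open>auto intro!: sum_nonneg\<close>)
  finally show ?thesis by simp
qed

text \<open>Telescoping along \<open>t ^ k * x\<close>; the remainder \<open>h (t ^ n * x)\<close>
  vanishes in the limit by continuity and \<open>h 0 = 0\<close>. As an \<open>ennreal\<close>
  series the bound can be integrated term by term without further conditions.\<close>

lemma square_le_suminf_dilation:
  fixes h :: "real \<Rightarrow> real"
  assumes "isCont h 0" "h 0 = 0" and t: "0 < t" "t < 1" and q: "0 < q" "q < 1"
  shows "ennreal ((h x)\<^sup>2) \<le>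
    (\<Sum>k. ennreal ((h (t ^ k * x) - h (t * (t ^ k * x)))\<^sup>2 / (q ^ k * (1 - q))))"
proof -
  define d where "d k = h (t ^ k * x) - h (t * (t ^ k * x))" for k
  have tel: "(\<Sum>k<n. d k) = h x - h (t ^ n * x)" for n
    by (induction n) (auto simp: d_def mult.assoc)
  have "(\<lambda>n. t ^ n * x) \<longlonglongrightarrow> 0 * x"
    by (intro tendsto_intros LIMSEQ_realpow_zero) (use t in auto)
  hence "(\<lambda>n. h (t ^ n * x)) \<longlonglongrightarrow> h 0"
    using assms(1) by (intro isCont_tendsto_compose[of 0 h]) auto
  hence "(\<lambda>n. (\<Sum>k<n. d k)\<^sup>2) \<longlonglongrightarrow> (h x - 0)\<^sup>2"
    unfolding tel using assms(2) by (intro tendsto_intros) auto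
  hence lim: "(\<lambda>n. ennreal ((\<Sum>k<n. d k)\<^sup>2)) \<longlonglongrightarrow> ennreal ((h x)\<^sup>2)"
    by (intro tendsto_ennrealI) auto
  have le: "ennreal ((\<Sum>k<n. d k)\<^sup>2) \<le> (\<Sum>k. ennreal ((d k)\<^sup>2 / (q ^ k * (1 - q))))" for n
  proof -
    have "ennreal ((\<Sum>k<n. d k)\<^sup>2) \<le> ennreal (\<Sum>k<n. (d k)\<^sup>2 / (q ^ k * (1 - q)))"
      using square_sum_le_geometric[OF q, of d n] by (intro ennreal_leI) (simp add: sum_divide_distrib)
    also have "\<dots> = (\<Sum>k<n. ennreal ((d k)\<^sup>2 / (q ^ k * (1 - q))))"
      using q by (subst sum_ennreal) auto
    also have "\<dots> \<le> (\<Sum>k. ennreal ((d k)\<^sup>2 / (q ^ k * (1 - q))))"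
      by (rule sum_le_suminf) auto
    finally show ?thesis .
  qed
  show ?thesis
    using LIMSEQ_le_const2[OF lim] le unfolding d_def by blast
qed

lemma nn_integral_real_scale:
  fixes f :: "real \<Rightarrow> ennreal"
  assumes "f \<in> borel_measurable borel" "0 < c"
  shows "(\<integral>\<^sup>+x. f (c * x) \<partial>lborel) = ennreal (1 / c) * (\<integral>\<^sup>+x. f x \<partial>lborel)"
proof -
  have "(\<integral>\<^sup>+x. f x \<partial>lborel) = ennreal c * (\<integral>\<^sup>+x. f (c * x) \<partial>lborel)"
    using nn_integral_real_affine[OF assms(1), of c 0] assms(2) by simp
  hence "ennreal (1 / c) * (\<integral>\<^sup>+x. f x \<partial>lborel) =
      ennreal (1 / c * c) * (\<integral>\<^sup>+x. f (c * x) \<partial>lborel)"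
    using assms(2) by (subst ennreal_mult) (auto simp: mult.assoc)
  thus ?thesis using assms(2) by simp
qed

text \<open>The weighted \<open>L\<^sup>2\<close> norm of \<open>x \<mapsto> h (t * x)\<close> is \<open>t powr (s - 1/2)\<close> times that of \<open>h\<close>, so the
  telescoping series of \<open>h\<close> along \<open>t ^ k * x\<close> converges geometrically in that norm.\<close>

lemma hardy_dilation:
  fixes h :: "real \<Rightarrow> real"
  assumes s: "1/2 < s" and h: "continuous_on UNIV h" "h 0 = 0"
    and t: "0 < t" "t \<le> 1/2"
  defines "q \<equiv> 2 powr (1/2 - s)"
  shows "(\<integral>\<^sup>+x. ennreal (indicator {0<..} x * (h x)\<^sup>2 * x powr (-2 * s)) \<partial>lborel) \<le>
     ennreal (1 / (1 - q)\<^sup>2) *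
     (\<integral>\<^sup>+x. ennreal (indicator {0<..} x * (h x - h (t*x))\<^sup>2 * x powr (-2 * s)) \<partial>lborel)"
proof -
  have q: "0 < q" "q < 1"
    using s powr_less_mono[of "1/2 - s" 0 2] by (auto simp: q_def)
  have [measurable]: "h \<in> borel_measurable borel"
    using h(1) by (rule borel_measurable_continuous_onI)
  define g where "g x = indicator {0<..} x * (h x - h (t*x))\<^sup>2 * x powr (-2 * s)" for x
  have g0: "0 \<le> g x" for x by (simp add: g_def)
  have gm[measurable]: "g \<in> borel_measurable borel" unfolding g_def by measurable
  have pt: "ennreal (indicator {0<..} x * (h x)\<^sup>2 * x powr (-2 * s))
      \<le> (\<Sum>k. ennreal (1 / (q ^ k * (1 - q)) * (t ^ k) powr (2 * s)) * ennreal (g (t ^ k * x)))" for x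
  proof (cases "x > 0")
    case True
    have "ennreal (indicator {0<..} x * (h x)\<^sup>2 * x powr (-2 * s)) = ennreal (x powr (-2 * s)) * ennreal ((h x)\<^sup>2)"
      using True by (subst ennreal_mult[symmetric]) (auto simp: mult.commute)
    also have "\<dots> \<le> ennreal (x powr (-2 * s)) *
      (\<Sum>k. ennreal ((h (t ^ k * x) - h (t * (t ^ k * x)))\<^sup>2 / (q ^ k * (1 - q))))"
      using h t q by (intro mult_left_mono square_le_suminf_dilation)
         (auto simp: continuous_on_eq_continuous_at)
    also have "\<dots> = (\<Sum>k. ennreal (x powr (-2 * s)) *
        ennreal ((h (t ^ k * x) - h (t * (t ^ k * x)))\<^sup>2 / (q ^ k * (1 - q))))"
      by simp
    also have "\<dots> = (\<Sum>k. ennreal (1 / (q ^ k * (1 - q)) * (t ^ k) powr (2 * s)) * ennreal (g (t ^ k * x)))"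
    proof (rule suminf_cong)
      fix k
      have "(t ^ k) powr (2 * s) * (t ^ k * x) powr (-2 * s) = x powr (-2 * s)"
        using t True by (simp add: powr_mult powr_minus field_simps)
      hence "x powr (-2 * s) * ((h (t ^ k * x) - h (t * (t ^ k * x)))\<^sup>2 / (q ^ k * (1 - q)))
        = 1 / (q ^ k * (1 - q)) * (t ^ k) powr (2 * s) * g (t ^ k * x)"
        using t True by (simp add: g_def field_simps)
      thus "ennreal (x powr (-2 * s)) * ennreal ((h (t ^ k * x) - h (t * (t ^ k * x)))\<^sup>2 / (q ^ k * (1 - q)))
        = ennreal (1 / (q ^ k * (1 - q)) * (t ^ k) powr (2 * s)) * ennreal (g (t ^ k * x))"
        using q t g0 by (simp flip: ennreal_mult)
    qed
    finally show ?thesis .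
  qed auto
  have scal: "(\<integral>\<^sup>+x. ennreal (1 / (q ^ k * (1 - q)) * (t ^ k) powr (2 * s)) * ennreal (g (t ^ k * x)) \<partial>lborel)
      \<le> ennreal (q ^ k * (1 / (1 - q))) * (\<integral>\<^sup>+x. ennreal (g x) \<partial>lborel)" for k
  proof -
    have "(\<integral>\<^sup>+x. ennreal (1 / (q ^ k * (1 - q)) * (t ^ k) powr (2 * s)) * ennreal (g (t ^ k * x)) \<partial>lborel)
      = ennreal (1 / (q ^ k * (1 - q)) * (t ^ k) powr (2 * s)) * (ennreal (1 / t ^ k) * (\<integral>\<^sup>+x. ennreal (g x) \<partial>lborel))"
      using t by (subst nn_integral_cmult) (auto simp: nn_integral_real_scale[of "\<lambda>x. ennreal (g x)"])
    also have "\<dots> = ennreal (1 / (q ^ k * (1 - q)) * (t ^ k) powr (2 * s) * (1 / t ^ k)) * (\<integral>\<^sup>+x. ennreal (g x) \<partial>lborel)"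
      using t q by (subst (2) ennreal_mult) (auto simp: mult.assoc)
    also have "\<dots> \<le> ennreal (q ^ k * (1 / (1 - q))) * (\<integral>\<^sup>+x. ennreal (g x) \<partial>lborel)"
    proof (intro mult_right_mono ennreal_leI)
      \<comment> \<open>The exponent \<open>2 * s\<close> comes from the weight, the
        \<open>- 1\<close> from the Jacobian of the substitution. As \<open>t \<le> 1/2\<close>, the
        ratio per step is at most \<open>q^2\<close>: one \<open>q\<close> pays for the weighted
        Cauchy-Schwarz inequality, the other leaves a convergent geometric series.\<close>
      have "(t ^ k) powr (2 * s) * (1 / t ^ k) = (t powr (2 * s - 1)) ^ k"
        using t by (simp add: powr_diff power_divide powr_power powr_realpow[symmetric] powr_powr mult.commute del: powr_realpow)
      also have "\<dots> \<le> ((1/2) powr (2 * s - 1)) ^ k"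
        using t s by (intro power_mono powr_mono2) auto
      also have "(1/2::real) powr (2 * s - 1) = q\<^sup>2"
        by (simp add: q_def powr_power powr_divide powr_minus_divide[symmetric] algebra_simps)
      finally have "(t ^ k) powr (2 * s) * (1 / t ^ k) \<le> q ^ k * q ^ k"
        by (simp add: power_even_eq power2_eq_square flip: power_mult_distrib power_add)
      hence "1 / (q ^ k * (1 - q)) * ((t ^ k) powr (2 * s) * (1 / t ^ k)) \<le> 1 / (q ^ k * (1 - q)) * (q ^ k * q ^ k)"
        using q by (intro mult_left_mono) auto
      also have "\<dots> = q ^ k * (1 / (1 - q))" using q by simp
      finally show "1 / (q ^ k * (1 - q)) * (t ^ k) powr (2 * s) * (1 / t ^ k) \<le> q ^ k * (1 / (1 - q))"
        by (simp only: mult.assoc)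
    qed auto
    finally show ?thesis .
  qed
  have "(\<integral>\<^sup>+x. ennreal (indicator {0<..} x * (h x)\<^sup>2 * x powr (-2 * s)) \<partial>lborel) \<le>
    (\<integral>\<^sup>+x. (\<Sum>k. ennreal (1 / (q ^ k * (1 - q)) * (t ^ k) powr (2 * s)) * ennreal (g (t ^ k * x))) \<partial>lborel)"
    by (intro nn_integral_mono pt)
  also have "\<dots> = (\<Sum>k. \<integral>\<^sup>+x. ennreal (1 / (q ^ k * (1 - q)) * (t ^ k) powr (2 * s)) * ennreal (g (t ^ k * x)) \<partial>lborel)"
    by (rule nn_integral_suminf) measurable
  also have "\<dots> \<le> (\<Sum>k. ennreal (q ^ k * (1 / (1 - q))) * (\<integral>\<^sup>+x. ennreal (g x) \<partial>lborel))"
    by (intro suminf_le scal) auto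
  also have "\<dots> = (\<Sum>k. ennreal (q ^ k * (1 / (1 - q)))) * (\<integral>\<^sup>+x. ennreal (g x) \<partial>lborel)"
    by simp
  also have "(\<Sum>k. ennreal (q ^ k * (1 / (1 - q)))) = ennreal (1 / (1 - q)\<^sup>2)"
  proof (rule suminf_ennreal_eq)
    show "(\<lambda>k. q ^ k * (1 / (1 - q))) sums (1 / (1 - q)\<^sup>2)"
      using sums_mult2[OF geometric_sums[of q], of "1 / (1 - q)"] q by (simp add: power2_eq_square)
  qed (use q in auto)
  finally show ?thesis by (simp add: g_def)
qed

text \<open>With \<open>q = 2 powr (1/2 - s)\<close>, one factor \<open>1 / (1 - q)\<close> comes
  from Cauchy-Schwarz and one from the series of dilations; 4 is the reciprocal of the length of
  \<open>[1/4, 1/2]\<close>.\<close>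

definition hardy_const :: "real \<Rightarrow> real" where
  "hardy_const s = 4 / (1 - 2 powr (1/2 - s))\<^sup>2"

text \<open>Iterated rather than over the product measure, so that substitutions in a single
  variable apply directly.\<close>

definition gag_on :: "real \<Rightarrow> real set \<Rightarrow> (real \<Rightarrow> real) \<Rightarrow> ennreal" where
  "gag_on s J w = (\<integral>\<^sup>+x. \<integral>\<^sup>+y. ennreal (indicator J x * indicator J y * (w x - w y)\<^sup>2 * kern s x y)
     \<partial>lborel \<partial>lborel)"

lemma kern_nonneg [simp]: "0 \<le> kern s x y"
  by (simp add: kern_def)

lemma kern_commute: "kern s x y = kern s y x"
  by (simp add: kern_def abs_minus_commute)

lemma kern_measurable [measurable (raw)]:
  assumes [measurable]: "f \<in> borel_measurable M" "g \<in> borel_measurable M"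
  shows "(\<lambda>x. kern s (f x) (g x)) \<in> borel_measurable M"
  unfolding kern_def by measurable

lemma hardy_const_nonneg: "0 \<le> hardy_const s"
  by (simp add: hardy_const_def)

text \<open>Averaging the previous bound over \<open>t \<in> [1/4, 1/2]\<close> and substituting \<open>y = t * x\<close> produces the
  double integral.\<close>

lemma hardy_half_line:
  fixes h :: "real \<Rightarrow> real"
  assumes s: "1/2 < s" and h: "continuous_on UNIV h" "h 0 = 0"
  shows "(\<integral>\<^sup>+x. ennreal (indicator {0<..} x * (h x)\<^sup>2 * x powr (-2 * s)) \<partial>lborel)
    \<le> ennreal (hardy_const s) * gag_on s {0<..} h"
proof -
  define q where "q = (2::real) powr (1/2 - s)"
  define L where "L = (\<integral>\<^sup>+x. ennreal (indicator {0<..} x * (h x)\<^sup>2 * x powr (-2 * s)) \<partial>lborel)"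
  define S where "S = {1/4..1/2::real}"
  have [measurable]: "h \<in> borel_measurable borel" "S \<in> sets borel"
    using h(1) by (auto intro: borel_measurable_continuous_onI simp: S_def)
  have "ennreal (1/4) * L = (\<integral>\<^sup>+t. indicator S t * L \<partial>lborel)"
    by (simp add: nn_integral_multc S_def)
  also have "\<dots> \<le> (\<integral>\<^sup>+t. ennreal (1 / (1 - q)\<^sup>2) * (\<integral>\<^sup>+x. ennreal (indicator S t * (indicator {0<..} x *
      (h x - h (t * x))\<^sup>2 * x powr (-2 * s))) \<partial>lborel) \<partial>lborel)"
    by (intro nn_integral_mono)
       (use hardy_dilation[OF s h] in \<open>auto simp: indicator_def S_def L_def q_def\<close>)
  also have "\<dots> = ennreal (1 / (1 - q)\<^sup>2) * (\<integral>\<^sup>+t. (\<integral>\<^sup>+x. ennreal (indicator S t * (indicator {0<..} x *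
      (h x - h (t * x))\<^sup>2 * x powr (-2 * s))) \<partial>lborel) \<partial>lborel)"
    by (rule nn_integral_cmult) measurable
  also have "(\<integral>\<^sup>+t. (\<integral>\<^sup>+x. ennreal (indicator S t * (indicator {0<..} x *
      (h x - h (t * x))\<^sup>2 * x powr (-2 * s))) \<partial>lborel) \<partial>lborel)
    = (\<integral>\<^sup>+x. (\<integral>\<^sup>+t. ennreal (indicator S t * (indicator {0<..} x *
      (h x - h (t * x))\<^sup>2 * x powr (-2 * s))) \<partial>lborel) \<partial>lborel)"
    by (rule lborel_pair.Fubini') measurable
  also have "\<dots> \<le> gag_on s {0<..} h"
    unfolding gag_on_def
  proof (rule nn_integral_mono)
    fix x :: real
    show "(\<integral>\<^sup>+t. ennreal (indicator S t * (indicator {0<..} x * (h x - h (t * x))\<^sup>2 * x powr (-2 * s))) \<partial>lborel)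
      \<le> (\<integral>\<^sup>+y. ennreal (indicator {0<..} x * indicator {0<..} y * (h x - h y)\<^sup>2 * kern s x y) \<partial>lborel)"
    proof (cases "x > 0")
      case True
      define G where "G y = ennreal (indicator S (y / x) * (h x - h y)\<^sup>2 * x powr (-2 * s))" for y
      have [measurable]: "G \<in> borel_measurable borel" unfolding G_def by measurable
      have "(\<integral>\<^sup>+t. ennreal (indicator S t * (indicator {0<..} x * (h x - h (t * x))\<^sup>2 * x powr (-2 * s))) \<partial>lborel)
        = (\<integral>\<^sup>+t. G (x * t) \<partial>lborel)"
        using True by (intro nn_integral_cong) (auto simp: G_def mult.commute mult.assoc)
      also have "\<dots> = ennreal (1 / x) * (\<integral>\<^sup>+y. G y \<partial>lborel)"
        using True by (intro nn_integral_real_scale) auto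
      also have "\<dots> = (\<integral>\<^sup>+y. ennreal (1 / x) * G y \<partial>lborel)"
        by (rule nn_integral_cmult[symmetric]) measurable
      also have "\<dots> \<le> (\<integral>\<^sup>+y. ennreal (indicator {0<..} x * indicator {0<..} y * (h x - h y)\<^sup>2 * kern s x y) \<partial>lborel)"
      proof (rule nn_integral_mono)
        fix y :: real
        show "ennreal (1 / x) * G y \<le> ennreal (indicator {0<..} x * indicator {0<..} y * (h x - h y)\<^sup>2 * kern s x y)"
        proof (cases "y / x \<in> S")
          case yS: True
          hence y: "0 < y" "y < x" using True by (auto simp: S_def field_simps)
          \<comment> \<open>The Jacobian \<open>1 / x\<close> raises the weight to the order of the
            kernel, and \<open>0 < y < x\<close> gives
            \<open>\<bar>x - y\<bar> \<le> x\<close>.\<close>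
          have "1 / x * x powr (-2 * s) = 1 / x powr (1 + 2 * s)"
            using True by (simp add: powr_add powr_minus divide_simps)
          also have "\<dots> \<le> kern s x y"
            unfolding kern_def using y s by (intro divide_left_mono powr_mono2) auto
          finally have "(h x - h y)\<^sup>2 * (1 / x * x powr (-2 * s)) \<le> (h x - h y)\<^sup>2 * kern s x y"
            by (intro mult_left_mono) auto
          thus ?thesis using yS y True
            by (auto simp: G_def mult_ac simp flip: ennreal_mult intro!: ennreal_leI)
        qed (simp add: G_def)
      qed
      finally show ?thesis .
    qed simp
  qed
  finally have "ennreal (1/4) * L \<le> ennreal (1 / (1 - q)\<^sup>2) * gag_on s {0<..} h"
    by (simp add: mult_left_mono)
  hence "ennreal 4 * (ennreal (1/4) * L) \<le> ennreal 4 * (ennreal (1 / (1 - q)\<^sup>2) * gag_on s {0<..} h)"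
    by (rule mult_left_mono) simp
  thus ?thesis
    by (simp only: mult.assoc[symmetric] flip: ennreal_mult')
       (simp add: L_def hardy_const_def q_def)
qed

text \<open>Translations and reflections preserve the kernel and Lebesgue measure, so either side of
  \<open>b\<close> reduces to the half-line at 0; the sign \<open>c\<close> selects the
  side.\<close>

lemma hardy_half_line_at:
  fixes w :: "real \<Rightarrow> real"
  assumes s: "1/2 < s" and w: "continuous_on UNIV w" "w b = 0" and c: "c = 1 \<or> c = -1"
  defines "J \<equiv> {x. 0 < c * (x - b)}"
  shows "(\<integral>\<^sup>+x. ennreal (indicator J x * (w x)\<^sup>2 * \<bar>x - b\<bar> powr (-2 * s)) \<partial>lborel)
    \<le> ennreal (hardy_const s) * gag_on s J w"
proof -
  define h where "h x = w (b + c * x)" for x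
  have [measurable]: "w \<in> borel_measurable borel" "J \<in> sets borel"
    using w(1) by (auto intro: borel_measurable_continuous_onI simp: J_def)
  have c0: "c \<noteq> 0" "\<bar>c\<bar> = 1" "c * c = 1" using c by auto
  have J: "indicator J (b + c * x) = (indicator {0<..} x :: real)" for x
    using c by (auto simp: J_def indicator_def)
  have ab: "\<bar>c * x\<bar> = \<bar>x\<bar>" "\<bar>c * x - c * y\<bar> = \<bar>x - y\<bar>" for x y using c by auto
  have aff: "(\<integral>\<^sup>+x. f x \<partial>lborel) = (\<integral>\<^sup>+x. f (b + c * x) \<partial>lborel)"
    if "f \<in> borel_measurable borel" for f
    using nn_integral_real_affine[OF that c0(1), of b] c0(2) by simp
  have h: "continuous_on UNIV h" "h 0 = 0"
    unfolding h_def using w by (auto intro!: continuous_intros continuous_on_compose2[OF w(1)])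
  have "(\<integral>\<^sup>+x. ennreal (indicator J x * (w x)\<^sup>2 * \<bar>x - b\<bar> powr (-2 * s)) \<partial>lborel)
    = (\<integral>\<^sup>+x. ennreal (indicator J (b + c * x) * (w (b + c * x))\<^sup>2 * \<bar>b + c * x - b\<bar> powr (-2 * s)) \<partial>lborel)"
    by (rule aff) measurable
  also have "\<dots> = (\<integral>\<^sup>+x. ennreal (indicator {0<..} x * (h x)\<^sup>2 * x powr (-2 * s)) \<partial>lborel)"
    unfolding J by (intro nn_integral_cong) (auto simp: h_def ab indicator_def)
  also have "\<dots> \<le> ennreal (hardy_const s) * gag_on s {0<..} h"
    by (rule hardy_half_line[OF s h])
  also have "gag_on s {0<..} h = (\<integral>\<^sup>+x. \<integral>\<^sup>+y. ennreal (indicator J (b + c * x) * indicator J (b + c * y) *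
      (w (b + c * x) - w (b + c * y))\<^sup>2 * kern s (b + c * x) (b + c * y)) \<partial>lborel \<partial>lborel)"
    unfolding gag_on_def J by (simp add: h_def kern_def ab)
  also have "\<dots> = (\<integral>\<^sup>+x. \<integral>\<^sup>+y. ennreal (indicator J (b + c * x) * indicator J y *
      (w (b + c * x) - w y)\<^sup>2 * kern s (b + c * x) y) \<partial>lborel \<partial>lborel)"
    by (intro nn_integral_cong aff[symmetric]) measurable
  also have "\<dots> = gag_on s J w"
    unfolding gag_on_def by (rule aff[symmetric]) measurable
  finally show ?thesis .
qed

section \<open>Interaction across \<open>b\<close> and bounds for point values\<close>

lemma nn_integral_powr_tail:
  fixes D s :: real
  assumes "0 < D" "0 < s"
  shows "(\<integral>\<^sup>+z. ennreal (1 / z powr (1 + 2 * s)) * indicator {D..} z \<partial>lborel) = ennreal (D powr (-2 * s) / (2 * s))"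
proof -
  have "(\<integral>\<^sup>+z. ennreal (1 / z powr (1 + 2 * s)) * indicator {D..} z \<partial>lborel)
     = ennreal (0 - (- (D powr (-2 * s)) / (2 * s)))"
  proof (rule nn_integral_FTC_atLeast)
    show "((\<lambda>z. - (z powr (-2 * s)) / (2 * s)) has_real_derivative 1 / x powr (1 + 2 * s)) (at x)"
      if "D \<le> x" for x
      using that assms
      by (auto intro!: derivative_eq_intros simp: powr_diff powr_minus powr_add field_simps)
    have "((\<lambda>z. - (z powr (-(2 * s))) / (2 * s)) \<longlongrightarrow> - 0 / (2 * s)) at_top"
      using assms by (intro tendsto_intros tendsto_neg_powr filterlim_ident) auto
    thus "((\<lambda>z. - (z powr (-2 * s)) / (2 * s)) \<longlongrightarrow> 0) at_top" by simp
  qed auto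
  thus ?thesis by simp
qed

text \<open>Seen from \<open>x\<close>, everything across \<open>b\<close> lies at distance at least
  \<open>\<bar>x - b\<bar>\<close>; the kernel tail beyond that distance produces the Hardy
  weight.\<close>

lemma nn_integral_kern_opposite_le:
  fixes b s x :: real
  assumes s: "0 < s" and x: "x \<noteq> b"
  shows "(\<integral>\<^sup>+y. ennreal (of_bool ((x - b) * (y - b) < 0) * kern s x y) \<partial>lborel)
    \<le> ennreal (\<bar>x - b\<bar> powr (-2 * s) / (2 * s))"
proof -
  \<comment> \<open>The direction from \<open>x\<close> towards \<open>b\<close>: with
    \<open>y = x + c * z\<close>, the points across \<open>b\<close> are those with
    \<open>z > \<bar>x - b\<bar>\<close>.\<close>
  define c :: real where "c = (if x < b then 1 else -1)"
  have c0: "c \<noteq> 0" "\<bar>c\<bar> = 1" by (auto simp: c_def)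
  have "(\<integral>\<^sup>+y. ennreal (of_bool ((x - b) * (y - b) < 0) * kern s x y) \<partial>lborel)
    = (\<integral>\<^sup>+z. ennreal (of_bool ((x - b) * (x + c * z - b) < 0) * kern s x (x + c * z)) \<partial>lborel)"
    using c0(2) by (subst nn_integral_real_affine[OF _ c0(1), of _ x]) auto
  also have "\<dots> \<le> (\<integral>\<^sup>+z. ennreal (1 / z powr (1 + 2 * s)) * indicator {\<bar>x - b\<bar>..} z \<partial>lborel)"
  proof (rule nn_integral_mono)
    fix z
    show "ennreal (of_bool ((x - b) * (x + c * z - b) < 0) * kern s x (x + c * z))
       \<le> ennreal (1 / z powr (1 + 2 * s)) * indicator {\<bar>x - b\<bar>..} z"
      using x by (auto simp: c_def kern_def mult_less_0_iff indicator_def)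
  qed
  also have "\<dots> = ennreal (\<bar>x - b\<bar> powr (-2 * s) / (2 * s))"
    using x s by (intro nn_integral_powr_tail) auto
  finally show ?thesis .
qed

lemma gag_nn_eq_iterated:
  assumes [measurable]: "w \<in> borel_measurable borel"
  shows "gag_nn s w = (\<integral>\<^sup>+x. \<integral>\<^sup>+y. ennreal ((w x - w y)\<^sup>2 * kern s x y) \<partial>lborel \<partial>lborel)"
  unfolding gag_nn_def
  by (subst lborel.nn_integral_fst[symmetric]) auto

lemma gag_on_le_gag_nn:
  assumes [measurable]: "w \<in> borel_measurable borel"
  shows "gag_on s J w \<le> gag_nn s w"
  unfolding gag_on_def gag_nn_eq_iterated[OF assms]
  by (intro nn_integral_mono) (auto simp: indicator_def)

text \<open>The 1 accounts for pairs on the same side of \<open>b\<close>. The rest is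
  \<open>4 * hardy_const s / (2 * s)\<close>: \<open>4 = 2 + 2\<close> from
  \<open>(p - r)^2 \<le> 2 * p^2 + 2 * r^2\<close>, whose two terms have equal integrals by
  symmetry, and \<open>1 / (2 * s)\<close> from the kernel tail.\<close>

definition split_const :: "real \<Rightarrow> real" where
  "split_const s = 1 + 2 * hardy_const s / s"

lemma split_const_pos: "0 < s \<Longrightarrow> 0 < split_const s"
  using hardy_const_nonneg[of s] by (auto simp: split_const_def intro!: add_pos_nonneg)

text \<open>Across \<open>b\<close> no cancellation between \<open>w x\<close> and
  \<open>w y\<close> is needed: since \<open>w b = 0\<close>, each square separately, integrated
  against the kernel tail, is controlled by Hardy's inequality on its own side.\<close>

lemma gag_nn_le_split:
  fixes w :: "real \<Rightarrow> real"
  assumes s: "1/2 < s" and w: "continuous_on UNIV w" "w b = 0"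
  shows "gag_nn s w \<le> ennreal (split_const s) * (gag_on s {..<b} w + gag_on s {b<..} w)"
proof -
  have [measurable]: "w \<in> borel_measurable borel"
    using w(1) by (auto intro: borel_measurable_continuous_onI)
  define G where "G = gag_on s {..<b} w + gag_on s {b<..} w"
  define P where "P x y = ennreal (of_bool ((x - b) * (y - b) < 0) * (w x)\<^sup>2 * kern s x y)" for x y
  define F where "F J x y = ennreal (indicator J x * indicator J y * (w x - w y)\<^sup>2 * kern s x y)" for J x y
  have [measurable]: "(\<lambda>(x, y). P x y) \<in> borel_measurable (lborel \<Otimes>\<^sub>M lborel)"
    unfolding P_def by measurable
  have [measurable]: "(\<lambda>(x, y). F {..<b} x y) \<in> borel_measurable (lborel \<Otimes>\<^sub>M lborel)"
      "(\<lambda>(x, y). F {b<..} x y) \<in> borel_measurable (lborel \<Otimes>\<^sub>M lborel)"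
    unfolding F_def by measurable
  have "{x. 0 < 1 * (x - b)} = {b<..}" "{x. 0 < -1 * (x - b)} = {..<b}" by auto
  note hardy = hardy_half_line_at[OF s w, of 1, simplified this(1)]
     hardy_half_line_at[OF s w, of "-1", simplified this(2)]
  have PI: "(\<integral>\<^sup>+x. \<integral>\<^sup>+y. P x y \<partial>lborel \<partial>lborel) \<le> ennreal (hardy_const s / (2 * s)) * G"
  proof -
    have "(\<integral>\<^sup>+x. \<integral>\<^sup>+y. P x y \<partial>lborel \<partial>lborel) \<le>
      (\<integral>\<^sup>+x. ennreal (1 / (2 * s)) * (ennreal (indicator {..<b} x * (w x)\<^sup>2 * \<bar>x - b\<bar> powr (-2 * s))
          + ennreal (indicator {b<..} x * (w x)\<^sup>2 * \<bar>x - b\<bar> powr (-2 * s))) \<partial>lborel)"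
    proof (rule nn_integral_mono)
      fix x
      show "(\<integral>\<^sup>+y. P x y \<partial>lborel) \<le> ennreal (1 / (2 * s)) * (ennreal (indicator {..<b} x * (w x)\<^sup>2 * \<bar>x - b\<bar> powr (-2 * s))
          + ennreal (indicator {b<..} x * (w x)\<^sup>2 * \<bar>x - b\<bar> powr (-2 * s)))"
      proof (cases "x = b")
        case False
        have "(\<integral>\<^sup>+y. P x y \<partial>lborel) = (\<integral>\<^sup>+y. ennreal ((w x)\<^sup>2) *
            ennreal (of_bool ((x - b) * (y - b) < 0) * kern s x y) \<partial>lborel)"
          unfolding P_def by (intro nn_integral_cong) (auto simp flip: ennreal_mult)
        also have "\<dots> = ennreal ((w x)\<^sup>2) * (\<integral>\<^sup>+y.
            ennreal (of_bool ((x - b) * (y - b) < 0) * kern s x y) \<partial>lborel)"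
          by (rule nn_integral_cmult) measurable
        also have "\<dots> \<le> ennreal ((w x)\<^sup>2) * ennreal (\<bar>x - b\<bar> powr (-2 * s) / (2 * s))"
          using s False by (intro mult_left_mono nn_integral_kern_opposite_le) auto
        also have "\<dots> = ennreal (1 / (2 * s)) * (ennreal (indicator {..<b} x * (w x)\<^sup>2 * \<bar>x - b\<bar> powr (-2 * s))
          + ennreal (indicator {b<..} x * (w x)\<^sup>2 * \<bar>x - b\<bar> powr (-2 * s)))"
          using False s by (auto simp: indicator_def mult_ac simp flip: ennreal_mult)
        finally show ?thesis .
      qed (use w in \<open>simp add: P_def\<close>)
    qed
    also have "\<dots> = ennreal (1 / (2 * s)) * ((\<integral>\<^sup>+x. ennreal (indicator {..<b} x * (w x)\<^sup>2 * \<bar>x - b\<bar> powr (-2 * s)) \<partial>lborel)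
          + (\<integral>\<^sup>+x. ennreal (indicator {b<..} x * (w x)\<^sup>2 * \<bar>x - b\<bar> powr (-2 * s)) \<partial>lborel))"
      by (subst nn_integral_cmult, measurable, subst nn_integral_add) auto
    also have "\<dots> \<le> ennreal (1 / (2 * s)) * (ennreal (hardy_const s) * gag_on s {..<b} w
         + ennreal (hardy_const s) * gag_on s {b<..} w)"
      using hardy by (intro mult_left_mono add_mono) auto
    also have "\<dots> = ennreal (hardy_const s / (2 * s)) * G"
      unfolding G_def distrib_left[symmetric] mult.assoc[symmetric]
      using s hardy_const_nonneg[of s] by (simp flip: ennreal_mult)
    finally show ?thesis .
  qed
  have "gag_nn s w \<le> (\<integral>\<^sup>+x. \<integral>\<^sup>+y. F {..<b} x y + (F {b<..} x y + (2 * P x y + 2 * P y x)) \<partial>lborel \<partial>lborel)"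
    unfolding gag_nn_eq_iterated[OF \<open>w \<in> borel_measurable borel\<close>]
  proof (rule nn_integral_mono_AE)
    \<comment> \<open>\<open>F\<close> and \<open>P\<close> vanish when a variable equals
      \<open>b\<close>, so the majorant is claimed only off these null lines.\<close>
    have ne: "AE x in lborel. x \<noteq> b" by (rule AE_lborel_singleton)
    show "AE x in lborel. (\<integral>\<^sup>+y. ennreal ((w x - w y)\<^sup>2 * kern s x y) \<partial>lborel)
       \<le> (\<integral>\<^sup>+y. F {..<b} x y + (F {b<..} x y + (2 * P x y + 2 * P y x)) \<partial>lborel)"
      using ne
    proof eventually_elim
      case (elim x)
      show ?case
      proof (rule nn_integral_mono_AE)
        show "AE y in lborel. ennreal ((w x - w y)\<^sup>2 * kern s x y)
            \<le> F {..<b} x y + (F {b<..} x y + (2 * P x y + 2 * P y x))"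
          using ne
        proof eventually_elim
          case (elim y)
          have "(w x - w y)\<^sup>2 \<le> 2 * (w x)\<^sup>2 + 2 * (w y)\<^sup>2"
            using zero_le_power2[of "w x + w y"] by (simp add: power2_eq_square algebra_simps)
          hence "(w x - w y)\<^sup>2 * kern s x y \<le> (2 * (w x)\<^sup>2 + 2 * (w y)\<^sup>2) * kern s x y"
            by (rule mult_right_mono) simp
          hence "ennreal ((w x - w y)\<^sup>2 * kern s x y) \<le>
             ennreal (2 * ((w x)\<^sup>2 * kern s x y) + 2 * ((w y)\<^sup>2 * kern s y x))"
            by (intro ennreal_leI) (simp add: kern_commute[of s y x] algebra_simps)
          also have "\<dots> = 2 * ennreal ((w x)\<^sup>2 * kern s x y) + 2 * ennreal ((w y)\<^sup>2 * kern s y x)"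
            by (simp add: ennreal_plus ennreal_mult)
          finally have "ennreal ((w x - w y)\<^sup>2 * kern s x y) \<le>
             2 * ennreal ((w x)\<^sup>2 * kern s x y) + 2 * ennreal ((w y)\<^sup>2 * kern s y x)" .
          thus ?case
            using elim \<open>x \<noteq> b\<close>
            by (cases "x < b"; cases "y < b")
               (auto simp: F_def P_def mult_less_0_iff)
        qed
      qed
    qed
  qed
  also have "\<dots> = (\<integral>\<^sup>+x. \<integral>\<^sup>+y. F {..<b} x y \<partial>lborel \<partial>lborel) + ((\<integral>\<^sup>+x. \<integral>\<^sup>+y. F {b<..} x y \<partial>lborel \<partial>lborel)
      + (2 * (\<integral>\<^sup>+x. \<integral>\<^sup>+y. P x y \<partial>lborel \<partial>lborel) + 2 * (\<integral>\<^sup>+x. \<integral>\<^sup>+y. P y x \<partial>lborel \<partial>lborel)))"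
    by (simp add: nn_integral_add nn_integral_cmult)
  also have "(\<integral>\<^sup>+x. \<integral>\<^sup>+y. P y x \<partial>lborel \<partial>lborel) = (\<integral>\<^sup>+x. \<integral>\<^sup>+y. P x y \<partial>lborel \<partial>lborel)"
    by (rule lborel_pair.Fubini') measurable
  also have "(\<integral>\<^sup>+x. \<integral>\<^sup>+y. F {..<b} x y \<partial>lborel \<partial>lborel) + ((\<integral>\<^sup>+x. \<integral>\<^sup>+y. F {b<..} x y \<partial>lborel \<partial>lborel)
      + (2 * (\<integral>\<^sup>+x. \<integral>\<^sup>+y. P x y \<partial>lborel \<partial>lborel) + 2 * (\<integral>\<^sup>+x. \<integral>\<^sup>+y. P x y \<partial>lborel \<partial>lborel)))
     = G + ennreal 4 * (\<integral>\<^sup>+x. \<integral>\<^sup>+y. P x y \<partial>lborel \<partial>lborel)"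
    unfolding G_def gag_on_def F_def by (simp add: add.assoc flip: distrib_right)
  also have "\<dots> \<le> ennreal 1 * G + ennreal 4 * (ennreal (hardy_const s / (2 * s)) * G)"
    using PI by (intro add_mono mult_left_mono) auto
  also have "\<dots> = ennreal (split_const s) * G"
    unfolding mult.assoc[symmetric] distrib_right[symmetric]
    using s hardy_const_nonneg[of s] by (simp only: flip: ennreal_mult' ennreal_plus)
       (simp add: split_const_def)
  finally show ?thesis by (simp add: G_def)
qed

text \<open>The Hardy inequality at \<open>a\<close> for \<open>w - w a\<close>, which is the constant \<open>- w a\<close> on \<open>(1, 2)\<close>.\<close>

lemma point_value_le_gag_nn:
  fixes w :: "real \<Rightarrow> real"
  assumes s: "1/2 < s" and w: "continuous_on UNIV w" "\<And>x. x \<notin> I0 \<Longrightarrow> w x = 0"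
  shows "ennreal ((w a)\<^sup>2) \<le> ennreal (hardy_const s * 2 powr (2 * s)) * gag_nn s w"
proof (cases "a \<in> I0")
  case True
  define v where "v x = w x - w a" for x
  have v: "continuous_on UNIV v" "v a = 0"
    unfolding v_def using w(1) by (auto intro!: continuous_intros)
  have wm: "w \<in> borel_measurable borel"
    using w(1) by (auto intro: borel_measurable_continuous_onI)
  have "ennreal ((w a)\<^sup>2 * 2 powr (-2 * s)) = (\<integral>\<^sup>+x. ennreal ((w a)\<^sup>2 * 2 powr (-2 * s)) * indicator {1<..<2::real} x \<partial>lborel)"
    by (subst nn_integral_cmult_indicator) auto
  also have "\<dots> \<le> (\<integral>\<^sup>+x. ennreal (indicator {x. 0 < 1 * (x - a)} x * (v x)\<^sup>2 * \<bar>x - a\<bar> powr (-2 * s)) \<partial>lborel)"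
  proof (rule nn_integral_mono)
    fix x
    show "ennreal ((w a)\<^sup>2 * 2 powr (-2 * s)) * indicator {1<..<2} x
      \<le> ennreal (indicator {x. 0 < 1 * (x - a)} x * (v x)\<^sup>2 * \<bar>x - a\<bar> powr (-2 * s))"
    proof (cases "x \<in> {1<..<2}")
      case x: True
      hence "w x = 0" by (intro w(2)) (auto simp: I0_def)
      \<comment> \<open>For \<open>a\<close> in \<open>I\<close> and \<open>x\<close> in
        \<open>(1, 2)\<close> the distance is below 2; this is the origin of the factor
        \<open>2 powr (2 * s)\<close> in the bound.\<close>
      moreover have "2 powr (-2 * s) \<le> \<bar>x - a\<bar> powr (-2 * s)"
        using x True s by (intro powr_mono2') (auto simp: I0_def)
      ultimately show ?thesis
        using x True by (auto simp: v_def I0_def intro!: ennreal_leI mult_left_mono)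
    qed auto
  qed
  also have "\<dots> \<le> ennreal (hardy_const s) * gag_on s {x. 0 < 1 * (x - a)} v"
    by (rule hardy_half_line_at[OF s v]) simp
  also have "gag_on s {x. 0 < 1 * (x - a)} v = gag_on s {x. 0 < 1 * (x - a)} w"
    by (simp add: gag_on_def v_def)
  also have "\<dots> \<le> gag_nn s w" by (rule gag_on_le_gag_nn[OF wm])
  finally have "ennreal (2 powr (2 * s)) * ennreal ((w a)\<^sup>2 * 2 powr (-2 * s))
      \<le> ennreal (2 powr (2 * s)) * (ennreal (hardy_const s) * gag_nn s w)"
    by (simp add: mult_left_mono)
  moreover have "ennreal (2 powr (2 * s)) * ennreal ((w a)\<^sup>2 * 2 powr (-2 * s)) = ennreal ((w a)\<^sup>2)"
    by (simp add: powr_minus flip: ennreal_mult)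
  moreover have "ennreal (2 powr (2 * s)) * (ennreal (hardy_const s) * gag_nn s w)
      = ennreal (hardy_const s * 2 powr (2 * s)) * gag_nn s w"
    using hardy_const_nonneg[of s] by (simp add: ennreal_mult mult.left_commute mult.assoc)
  ultimately show ?thesis by (simp only:)
qed (use w in simp)

section \<open>The form and the norm\<close>

text \<open>The conditions on a coefficient that make \<open>aform\<close> a bounded bilinear form.
  The constant coefficient 1 satisfies them, so the algebra of the norm is a special case of that of
  the form.\<close>

definition coef_bound :: "(real \<Rightarrow> real \<Rightarrow> real) \<Rightarrow> real \<Rightarrow> bool" where
  "coef_bound \<sigma> M \<longleftrightarrow>
     (\<lambda>p. \<sigma> (fst p) (snd p)) \<in> borel_measurable (lborel \<Otimes>\<^sub>M lborel) \<and> (\<forall>x y. \<bar>\<sigma> x y\<bar> \<le> M)"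

lemma coef_bound_one: "coef_bound (\<lambda>_ _. 1) 1"
  by (simp add: coef_bound_def)

lemma Cs_pos: "0 < s \<Longrightarrow> s < 1 \<Longrightarrow> 0 < Cs s"
  by (simp add: Cs_def Gamma_real_pos)

lemma HtildeD:
  assumes "w \<in> Htilde s"
  shows "continuous_on UNIV w" "x \<notin> I0 \<Longrightarrow> w x = 0" "w \<in> borel_measurable borel"
  using assms by (auto simp: Htilde_def intro: borel_measurable_continuous_onI)

lemma Htilde_iff:
  "w \<in> Htilde s \<longleftrightarrow> continuous_on UNIV w \<and> (\<forall>x. x \<notin> I0 \<longrightarrow> w x = 0) \<and>
     integrable (lborel \<Otimes>\<^sub>M lborel) (\<lambda>p. (w (fst p) - w (snd p))\<^sup>2 * kern s (fst p) (snd p))"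
proof -
  have "gag_nn s w < \<infinity> \<longleftrightarrow>
      integrable (lborel \<Otimes>\<^sub>M lborel) (\<lambda>p. (w (fst p) - w (snd p))\<^sup>2 * kern s (fst p) (snd p))"
    if "continuous_on UNIV w"
  proof -
    have [measurable]: "w \<in> borel_measurable borel"
      using that by (auto intro: borel_measurable_continuous_onI)
    show ?thesis by (simp add: gag_nn_def integrable_iff_bounded)
  qed
  thus ?thesis by (auto simp: Htilde_def)
qed

lemma gag_nn_eq_Hnorm2:
  assumes "w \<in> Htilde s" "0 < s" "s < 1"
  shows "gag_nn s w = ennreal (2 / Cs s * Hnorm2 s w)"
  unfolding gag_nn_def Hnorm2_def using assms Cs_pos[of s]
  by (subst nn_integral_eq_integral) (auto simp: Htilde_iff)

lemma Hnorm2_eq_aform: "Hnorm2 s w = aform s (\<lambda>_ _. 1) w w"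
  by (simp add: Hnorm2_def aform_def power2_eq_square)

lemma aform_integrable:
  assumes \<sigma>: "coef_bound \<sigma> M" and u: "u \<in> Htilde s" and v: "v \<in> Htilde s"
  shows "integrable (lborel \<Otimes>\<^sub>M lborel)
    (\<lambda>p. \<sigma> (fst p) (snd p) * (u (fst p) - u (snd p)) * (v (fst p) - v (snd p)) * kern s (fst p) (snd p))"
proof (rule Bochner_Integration.integrable_bound)
  have [measurable]: "u \<in> borel_measurable borel" "v \<in> borel_measurable borel"
    "(\<lambda>p. \<sigma> (fst p) (snd p)) \<in> borel_measurable (lborel \<Otimes>\<^sub>M lborel)"
    using HtildeD(3)[OF u] HtildeD(3)[OF v] \<sigma> by (auto simp: coef_bound_def)
  show "integrable (lborel \<Otimes>\<^sub>M lborel) (\<lambda>p. M * ((u (fst p) - u (snd p))\<^sup>2 * kern s (fst p) (snd p)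
     + (v (fst p) - v (snd p))\<^sup>2 * kern s (fst p) (snd p)))"
    using u v by (auto simp: Htilde_iff)
  show "(\<lambda>p. \<sigma> (fst p) (snd p) * (u (fst p) - u (snd p)) * (v (fst p) - v (snd p)) * kern s (fst p) (snd p))
      \<in> borel_measurable (lborel \<Otimes>\<^sub>M lborel)" by measurable
  show "AE p in lborel \<Otimes>\<^sub>M lborel.
    norm (\<sigma> (fst p) (snd p) * (u (fst p) - u (snd p)) * (v (fst p) - v (snd p)) * kern s (fst p) (snd p))
    \<le> norm (M * ((u (fst p) - u (snd p))\<^sup>2 * kern s (fst p) (snd p)
     + (v (fst p) - v (snd p))\<^sup>2 * kern s (fst p) (snd p)))"
  proof (rule AE_I2)
    fix p :: "real \<times> real"
    define a b k where "a = u (fst p) - u (snd p)" "b = v (fst p) - v (snd p)" "k = kern s (fst p) (snd p)"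
    have M: "\<bar>\<sigma> (fst p) (snd p)\<bar> \<le> M" using \<sigma> by (auto simp: coef_bound_def)
    have "\<bar>a * b\<bar> \<le> a\<^sup>2 + b\<^sup>2"
      using sum_squares_bound[of "\<bar>a\<bar>" "\<bar>b\<bar>"] abs_ge_zero[of "a * b"]
      by (simp only: abs_mult power2_abs)
    hence "\<bar>\<sigma> (fst p) (snd p)\<bar> * \<bar>a * b\<bar> \<le> M * (a\<^sup>2 + b\<^sup>2)"
      using M by (intro mult_mono) auto
    hence "\<bar>\<sigma> (fst p) (snd p)\<bar> * \<bar>a * b\<bar> * k \<le> M * (a\<^sup>2 + b\<^sup>2) * k"
      by (rule mult_right_mono) (simp add: a_b_k_def)
    moreover have "0 \<le> M" "0 \<le> k" using M by (auto simp: a_b_k_def)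
    ultimately show "norm (\<sigma> (fst p) (snd p) * (u (fst p) - u (snd p)) * (v (fst p) - v (snd p)) * kern s (fst p) (snd p))
      \<le> norm (M * ((u (fst p) - u (snd p))\<^sup>2 * kern s (fst p) (snd p)
       + (v (fst p) - v (snd p))\<^sup>2 * kern s (fst p) (snd p)))"
      unfolding a_b_k_def[symmetric] by (simp add: abs_mult algebra_simps)
  qed
qed

lemma Htilde_zero: "(\<lambda>x. 0) \<in> Htilde s"
  by (simp add: Htilde_iff)

lemma Htilde_scale:
  assumes "u \<in> Htilde s"
  shows "(\<lambda>x. c * u x) \<in> Htilde s"
proof -
  have "(\<lambda>p. (c * u (fst p) - c * u (snd p))\<^sup>2 * kern s (fst p) (snd p))
     = (\<lambda>p. c\<^sup>2 * ((u (fst p) - u (snd p))\<^sup>2 * kern s (fst p) (snd p)))"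
    by (auto simp: power2_eq_square algebra_simps)
  thus ?thesis using assms by (auto simp: Htilde_iff intro!: continuous_intros)
qed

lemma Htilde_add:
  assumes "u \<in> Htilde s" "v \<in> Htilde s"
  shows "(\<lambda>x. u x + v x) \<in> Htilde s"
proof -
  have "integrable (lborel \<Otimes>\<^sub>M lborel) (\<lambda>p. (u (fst p) - u (snd p))\<^sup>2 * kern s (fst p) (snd p)
     + (v (fst p) - v (snd p))\<^sup>2 * kern s (fst p) (snd p)
     + 2 * (1 * (u (fst p) - u (snd p)) * (v (fst p) - v (snd p)) * kern s (fst p) (snd p)))"
    using assms aform_integrable[OF coef_bound_one assms]
    by (intro Bochner_Integration.integrable_add integrable_mult_right) (auto simp: Htilde_iff)
  also have "(\<lambda>p. (u (fst p) - u (snd p))\<^sup>2 * kern s (fst p) (snd p)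
     + (v (fst p) - v (snd p))\<^sup>2 * kern s (fst p) (snd p)
     + 2 * (1 * (u (fst p) - u (snd p)) * (v (fst p) - v (snd p)) * kern s (fst p) (snd p)))
    = (\<lambda>p. (u (fst p) + v (fst p) - (u (snd p) + v (snd p)))\<^sup>2 * kern s (fst p) (snd p))"
    by (auto simp: power2_eq_square algebra_simps)
  finally show ?thesis using assms by (auto simp: Htilde_iff intro!: continuous_intros)
qed

lemma Htilde_diff:
  assumes "u \<in> Htilde s" "v \<in> Htilde s"
  shows "(\<lambda>x. u x - v x) \<in> Htilde s"
  using Htilde_add[OF assms(1) Htilde_scale[OF assms(2), of "-1"]] by simp

lemma aform_commute: "aform s \<sigma> u v = aform s \<sigma> v u"
  by (simp add: aform_def mult_ac)

lemma aform_scale_left: "aform s \<sigma> (\<lambda>x. c * u x) v = c * aform s \<sigma> u v"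
proof -
  have "(\<lambda>p. \<sigma> (fst p) (snd p) * (c * u (fst p) - c * u (snd p)) * (v (fst p) - v (snd p)) * kern s (fst p) (snd p))
    = (\<lambda>p. c * (\<sigma> (fst p) (snd p) * (u (fst p) - u (snd p)) * (v (fst p) - v (snd p)) * kern s (fst p) (snd p)))"
    by (auto simp: algebra_simps)
  thus ?thesis by (simp add: aform_def)
qed

lemma aform_scale_right: "aform s \<sigma> u (\<lambda>x. c * v x) = c * aform s \<sigma> u v"
  by (simp add: aform_commute[of s \<sigma> u] aform_scale_left)

lemma aform_add_left:
  assumes "coef_bound \<sigma> M" "u \<in> Htilde s" "w \<in> Htilde s" "v \<in> Htilde s"
  shows "aform s \<sigma> (\<lambda>x. u x + w x) v = aform s \<sigma> u v + aform s \<sigma> w v"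
proof -
  have "(\<lambda>p. \<sigma> (fst p) (snd p) * (u (fst p) + w (fst p) - (u (snd p) + w (snd p))) * (v (fst p) - v (snd p)) * kern s (fst p) (snd p))
    = (\<lambda>p. \<sigma> (fst p) (snd p) * (u (fst p) - u (snd p)) * (v (fst p) - v (snd p)) * kern s (fst p) (snd p)
     + \<sigma> (fst p) (snd p) * (w (fst p) - w (snd p)) * (v (fst p) - v (snd p)) * kern s (fst p) (snd p))"
    by (auto simp: algebra_simps)
  thus ?thesis
    using aform_integrable[OF assms(1,2,4)] aform_integrable[OF assms(1,3,4)]
    by (simp add: aform_def distrib_left)
qed

lemma aform_add_right:
  assumes "coef_bound \<sigma> M" "u \<in> Htilde s" "w \<in> Htilde s" "v \<in> Htilde s"
  shows "aform s \<sigma> v (\<lambda>x. u x + w x) = aform s \<sigma> v u + aform s \<sigma> v w"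
  using aform_add_left[OF assms] by (simp add: aform_commute)

lemma aform_diff_left:
  assumes "coef_bound \<sigma> M" "u \<in> Htilde s" "w \<in> Htilde s" "v \<in> Htilde s"
  shows "aform s \<sigma> (\<lambda>x. u x - w x) v = aform s \<sigma> u v - aform s \<sigma> w v"
  using aform_add_left[OF assms(1,2) Htilde_scale[OF assms(3), of "-1"] assms(4)]
    aform_scale_left[of s \<sigma> "-1" w v] by simp

lemma aform_diff_right:
  assumes "coef_bound \<sigma> M" "u \<in> Htilde s" "w \<in> Htilde s" "v \<in> Htilde s"
  shows "aform s \<sigma> v (\<lambda>x. u x - w x) = aform s \<sigma> v u - aform s \<sigma> v w"
  using aform_diff_left[OF assms] by (simp add: aform_commute)

lemma Hnorm2_nonneg: "0 < s \<Longrightarrow> s < 1 \<Longrightarrow> 0 \<le> Hnorm2 s w"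
  using Cs_pos[of s] by (auto simp: Hnorm2_def intro!: mult_nonneg_nonneg integral_nonneg_AE)

lemma Hnorm_nonneg: "0 < s \<Longrightarrow> s < 1 \<Longrightarrow> 0 \<le> Hnorm s w"
  by (simp add: Hnorm_def Hnorm2_nonneg)

lemma Hnorm_square: "0 < s \<Longrightarrow> s < 1 \<Longrightarrow> (Hnorm s w)\<^sup>2 = Hnorm2 s w"
  by (simp add: Hnorm_def Hnorm2_nonneg)

lemma Hnorm2_scale: "Hnorm2 s (\<lambda>x. c * u x) = c\<^sup>2 * Hnorm2 s u"
  by (simp add: Hnorm2_eq_aform aform_scale_left aform_scale_right power2_eq_square)

lemma Hnorm_scale: "Hnorm s (\<lambda>x. c * u x) = \<bar>c\<bar> * Hnorm s u"
  by (simp add: Hnorm_def Hnorm2_scale real_sqrt_mult)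

definition point_const :: "real \<Rightarrow> real" where
  "point_const s = hardy_const s * 2 powr (2 * s) * (2 / Cs s)"

lemma point_const_nonneg: "0 < s \<Longrightarrow> s < 1 \<Longrightarrow> 0 \<le> point_const s"
  using Cs_pos[of s] hardy_const_nonneg[of s] by (simp add: point_const_def)

lemma point_value_le_Hnorm2:
  assumes s: "1/2 < s" "s < 1" and w: "w \<in> Htilde s"
  shows "(w a)\<^sup>2 \<le> point_const s * Hnorm2 s w"
proof -
  have "ennreal ((w a)\<^sup>2) \<le> ennreal (hardy_const s * 2 powr (2 * s)) * ennreal (2 / Cs s * Hnorm2 s w)"
    using point_value_le_gag_nn[OF s(1) HtildeD(1,2)[OF w], of a] s
    by (simp add: gag_nn_eq_Hnorm2[OF w])
  also have "\<dots> = ennreal (point_const s * Hnorm2 s w)"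
    using hardy_const_nonneg[of s] s
    by (subst ennreal_mult'[symmetric]) (simp_all add: point_const_def mult_ac)
  finally show ?thesis
    using point_const_nonneg[of s] Hnorm2_nonneg[of s w] s by (subst (asm) ennreal_le_iff) auto
qed

lemma abs_point_value_le_Hnorm:
  assumes s: "1/2 < s" "s < 1" and w: "w \<in> Htilde s"
  shows "\<bar>w a\<bar> \<le> sqrt (point_const s) * Hnorm s w"
  using real_sqrt_le_mono[OF point_value_le_Hnorm2[OF assms, of a]]
  by (simp add: Hnorm_def real_sqrt_mult)

lemma Hnorm_zero: "Hnorm s (\<lambda>x. 0) = 0" "Hnorm2 s (\<lambda>x. 0) = 0"
  by (simp_all add: Hnorm_def Hnorm2_def)

text \<open>Definiteness holds for functions, not merely up to null sets: a nonzero value at a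
  single point already bounds the norm from below.\<close>

lemma Hnorm_pos:
  assumes s: "1/2 < s" "s < 1" and w: "w \<in> Htilde s" "w \<noteq> (\<lambda>x. 0)"
  shows "0 < Hnorm s w"
proof -
  obtain a where "w a \<noteq> 0" using w(2) by auto
  hence "0 < sqrt (point_const s) * Hnorm s w"
    using abs_point_value_le_Hnorm[OF s w(1), of a] by linarith
  thus ?thesis using Hnorm_nonneg[of s w] s by (auto simp: zero_less_mult_iff)
qed

lemma abs_aform_le_Hnorm2:
  assumes s: "0 < s" "s < 1" and \<sigma>: "coef_bound \<sigma> M" and u: "u \<in> Htilde s" and v: "v \<in> Htilde s"
  shows "\<bar>aform s \<sigma> u v\<bar> \<le> M / 2 * (Hnorm2 s u + Hnorm2 s v)"
proof -
  let ?N = "lborel \<Otimes>\<^sub>M lborel :: (real \<times> real) measure"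
  let ?f = "\<lambda>p. \<sigma> (fst p) (snd p) * (u (fst p) - u (snd p)) * (v (fst p) - v (snd p)) * kern s (fst p) (snd p)"
  let ?g = "\<lambda>w p. (w (fst p) - w (snd p))\<^sup>2 * kern s (fst p) (snd p) :: real"
  have ig: "integrable ?N (?g u)" "integrable ?N (?g v)" using u v by (auto simp: Htilde_iff)
  have "\<bar>integral\<^sup>L ?N ?f\<bar> \<le> (\<integral>p. \<bar>?f p\<bar> \<partial>?N)"
    using integral_norm_bound[of ?N ?f] by simp
  also have "\<dots> \<le> (\<integral>p. M / 2 * (?g u p + ?g v p) \<partial>?N)"
  proof (rule integral_mono)
    show "integrable ?N (\<lambda>p. \<bar>?f p\<bar>)"
      by (rule integrable_abs[OF aform_integrable[OF \<sigma> u v]])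
    show "integrable ?N (\<lambda>p. M / 2 * (?g u p + ?g v p))"
      by (intro integrable_mult_right Bochner_Integration.integrable_add ig)
    fix p :: "real \<times> real"
    define a b k where "a = u (fst p) - u (snd p)" "b = v (fst p) - v (snd p)" "k = kern s (fst p) (snd p)"
    have M: "\<bar>\<sigma> (fst p) (snd p)\<bar> \<le> M" using \<sigma> by (auto simp: coef_bound_def)
    have "\<bar>a * b\<bar> \<le> 1 / 2 * (a\<^sup>2 + b\<^sup>2)"
      using sum_squares_bound[of "\<bar>a\<bar>" "\<bar>b\<bar>"] by (simp add: abs_mult)
    hence "\<bar>\<sigma> (fst p) (snd p)\<bar> * \<bar>a * b\<bar> \<le> M * (1 / 2 * (a\<^sup>2 + b\<^sup>2))"
      using M by (intro mult_mono) auto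
    hence "\<bar>\<sigma> (fst p) (snd p)\<bar> * \<bar>a * b\<bar> * k \<le> M * (1 / 2 * (a\<^sup>2 + b\<^sup>2)) * k"
      by (rule mult_right_mono) (simp add: a_b_k_def)
    moreover have "0 \<le> k" by (auto simp: a_b_k_def)
    ultimately show "\<bar>?f p\<bar> \<le> M / 2 * (?g u p + ?g v p)"
      unfolding a_b_k_def[symmetric] by (simp add: abs_mult algebra_simps)
  qed
  also have "\<dots> = M / 2 * (integral\<^sup>L ?N (?g u) + integral\<^sup>L ?N (?g v))"
    using ig by simp
  finally have "Cs s / 2 * \<bar>integral\<^sup>L ?N ?f\<bar> \<le> Cs s / 2 * (M / 2 * (integral\<^sup>L ?N (?g u) + integral\<^sup>L ?N (?g v)))"
    using Cs_pos[OF s] by (intro mult_left_mono) auto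
  thus ?thesis
    using Cs_pos[OF s] by (simp add: aform_def Hnorm2_def abs_mult algebra_simps)
qed

text \<open>Scaling both arguments to norm 1 turns the bound by the arithmetic mean of the squares
  into the product bound, with the same \<open>M\<close>.\<close>

lemma abs_aform_le_Hnorm:
  assumes s: "1/2 < s" "s < 1" and \<sigma>: "coef_bound \<sigma> M" and u: "u \<in> Htilde s" and v: "v \<in> Htilde s"
  shows "\<bar>aform s \<sigma> u v\<bar> \<le> M * Hnorm s u * Hnorm s v"
proof (cases "u = (\<lambda>x. 0) \<or> v = (\<lambda>x. 0)")
  case True
  thus ?thesis by (auto simp: aform_def Hnorm_zero)
next
  case False
  define a b where "a = Hnorm s u" "b = Hnorm s v"
  have ab: "0 < a" "0 < b" using False Hnorm_pos[OF s u] Hnorm_pos[OF s v] by (auto simp: a_b_def)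
  have sq: "Hnorm2 s u = a\<^sup>2" "Hnorm2 s v = b\<^sup>2" using s by (auto simp: a_b_def Hnorm_square)
  have "\<bar>aform s \<sigma> (\<lambda>x. 1 / a * u x) (\<lambda>x. 1 / b * v x)\<bar>
     \<le> M / 2 * (Hnorm2 s (\<lambda>x. 1 / a * u x) + Hnorm2 s (\<lambda>x. 1 / b * v x))"
    using s by (intro abs_aform_le_Hnorm2 \<sigma> Htilde_scale u v) auto
  also have "\<dots> = M"
    unfolding Hnorm2_scale sq using ab by (simp add: power_divide)
  finally have "\<bar>aform s \<sigma> u v\<bar> / (a * b) \<le> M"
    using ab by (simp only: aform_scale_left aform_scale_right abs_mult) (simp add: mult_ac)
  thus ?thesis using ab unfolding a_b_def[symmetric] by (simp add: field_simps)
qed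

text \<open>The parallelogram law with the nonnegative term of \<open>u - v\<close> dropped.\<close>

lemma Hnorm2_add_le:
  assumes s: "0 < s" "s < 1" and "u \<in> Htilde s" "v \<in> Htilde s"
  shows "Hnorm2 s (\<lambda>x. u x + v x) \<le> 2 * Hnorm2 s u + 2 * Hnorm2 s v"
proof -
  have "0 \<le> Hnorm2 s (\<lambda>x. u x - v x)" using s by (rule Hnorm2_nonneg)
  thus ?thesis using assms
    unfolding Hnorm2_eq_aform
    by (simp add: aform_add_left[OF coef_bound_one] aform_add_right[OF coef_bound_one] Htilde_add
      Htilde_diff aform_diff_left[OF coef_bound_one] aform_diff_right[OF coef_bound_one])
qed

text \<open>Bounded point evaluation makes a Cauchy sequence uniformly Cauchy, which yields a
  continuous limit vanishing outside \<open>I\<close>. Fatou's lemma, with one index fixed, then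
  bounds the norm of \<open>v n - w\<close>. Pointwise convergence is recorded so that the condition
  \<open>v b = 0\<close> survives the limit.\<close>

lemma Htilde_complete:
  fixes v :: "nat \<Rightarrow> real \<Rightarrow> real"
  assumes s: "1/2 < s" "s < 1" and v: "\<And>n. v n \<in> Htilde s"
    and cauchy: "\<And>e. 0 < e \<Longrightarrow> \<exists>N. \<forall>m\<ge>N. \<forall>n\<ge>N. Hnorm2 s (\<lambda>x. v m x - v n x) \<le> e"
  obtains w where "w \<in> Htilde s" "(\<lambda>n. Hnorm2 s (\<lambda>x. v n x - w x)) \<longlonglongrightarrow> 0"
    "\<And>x. (\<lambda>n. v n x) \<longlonglongrightarrow> w x"
proof -
  have s0: "0 < s" using s by simp
  \<comment> \<open>In the choice of \<open>d\<close> below, the \<open>+ 1\<close> keeps the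
    denominator positive, since \<open>point_const s\<close> is only known to be
    nonnegative.\<close>
  have "uniformly_Cauchy_on UNIV v"
  proof (rule uniformly_Cauchy_onI)
    fix e :: real assume e: "0 < e"
    define d where "d = e\<^sup>2 / (2 * (point_const s + 1))"
    have pc: "0 \<le> point_const s" using s0 s(2) by (rule point_const_nonneg)
    have d: "0 < d" using e pc by (simp add: d_def)
    have pd: "point_const s * d < e\<^sup>2"
    proof -
      have "point_const s * d \<le> (point_const s + 1) * d" using d by simp
      also have "\<dots> = e\<^sup>2 / 2" using pc by (simp add: d_def field_simps)
      also have "\<dots> < e\<^sup>2" using e by simp
      finally show ?thesis .
    qed
    obtain N where N: "\<And>m n. m \<ge> N \<Longrightarrow> n \<ge> N \<Longrightarrow> Hnorm2 s (\<lambda>x. v m x - v n x) \<le> d"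
      using cauchy[OF d] by blast
    show "\<exists>N. \<forall>x\<in>UNIV. \<forall>m\<ge>N. \<forall>n\<ge>N. dist (v m x) (v n x) < e"
    proof (intro exI ballI allI impI)
      fix x m n assume "N \<le> m" "N \<le> n"
      have "(v m x - v n x)\<^sup>2 \<le> point_const s * Hnorm2 s (\<lambda>x. v m x - v n x)"
        by (rule point_value_le_Hnorm2[OF s Htilde_diff[OF v v]])
      also have "\<dots> \<le> point_const s * d"
        using pc N[OF \<open>N \<le> m\<close> \<open>N \<le> n\<close>] by (intro mult_left_mono)
      finally have "(v m x - v n x)\<^sup>2 < e\<^sup>2" using pd by linarith
      hence "\<bar>v m x - v n x\<bar> < \<bar>e\<bar>" using abs_le_square_iff[of e "v m x - v n x"] by linarith
      thus "dist (v m x) (v n x) < e" using e by (simp add: dist_real_def)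
    qed
  qed
  then obtain w where ul: "uniform_limit UNIV v w sequentially"
    using uniformly_convergent_on_def Cauchy_uniformly_convergent by blast
  have lim: "(\<lambda>n. v n x) \<longlonglongrightarrow> w x" for x
    by (rule tendsto_uniform_limitI[OF ul]) simp
  have wc: "continuous_on UNIV w"
    by (rule uniform_limit_theorem[OF _ ul]) (use HtildeD(1)[OF v] in auto)
  have w0: "w x = 0" if "x \<notin> I0" for x
    using lim[of x] HtildeD(2)[OF v that] by (simp add: LIMSEQ_const_iff)
  have [measurable]: "w \<in> borel_measurable borel" "v n \<in> borel_measurable borel" for n
    using wc HtildeD(3)[OF v] by (auto intro: borel_measurable_continuous_onI)
  have fatou: "gag_nn s (\<lambda>x. v n x - w x) \<le> ennreal (2 / Cs s * e)"
    if N: "\<And>m. m \<ge> N \<Longrightarrow> Hnorm2 s (\<lambda>x. v n x - v m x) \<le> e" for n N e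
  proof -
    have "gag_nn s (\<lambda>x. v n x - w x) = (\<integral>\<^sup>+p. liminf (\<lambda>m. ennreal
        ((v n (fst p) - v m (fst p) - (v n (snd p) - v m (snd p)))\<^sup>2 * kern s (fst p) (snd p))) \<partial>(lborel \<Otimes>\<^sub>M lborel))"
      unfolding gag_nn_def
    proof (rule nn_integral_cong)
      fix p :: "real \<times> real"
      have "(\<lambda>m. ennreal ((v n (fst p) - v m (fst p) - (v n (snd p) - v m (snd p)))\<^sup>2 * kern s (fst p) (snd p)))
        \<longlonglongrightarrow> ennreal ((v n (fst p) - w (fst p) - (v n (snd p) - w (snd p)))\<^sup>2 * kern s (fst p) (snd p))"
        by (intro tendsto_intros lim)
      thus "ennreal ((v n (fst p) - w (fst p) - (v n (snd p) - w (snd p)))\<^sup>2 * kern s (fst p) (snd p))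
        = liminf (\<lambda>m. ennreal ((v n (fst p) - v m (fst p) - (v n (snd p) - v m (snd p)))\<^sup>2 * kern s (fst p) (snd p)))"
        by (intro lim_imp_Liminf[symmetric]) auto
    qed
    also have "\<dots> \<le> liminf (\<lambda>m. gag_nn s (\<lambda>x. v n x - v m x))"
      unfolding gag_nn_def by (intro nn_integral_liminf) measurable
    also have "\<dots> \<le> ennreal (2 / Cs s * e)"
    proof (rule Liminf_le)
      show "\<forall>\<^sub>F m in sequentially. gag_nn s (\<lambda>x. v n x - v m x) \<le> ennreal (2 / Cs s * e)"
        using eventually_ge_at_top[of N]
      proof eventually_elim
        case (elim m)
        thus ?case
          using N[OF elim] Cs_pos[OF s0 s(2)] s0 s(2)
          by (subst gag_nn_eq_Hnorm2[OF Htilde_diff[OF v v]]) (auto intro!: ennreal_leI divide_right_mono mult_left_mono)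
      qed
    qed simp
    finally show ?thesis .
  qed
  have diff: "(\<lambda>x. v n x - w x) \<in> Htilde s \<and> Hnorm2 s (\<lambda>x. v n x - w x) \<le> e"
    if N: "\<And>m. m \<ge> N \<Longrightarrow> Hnorm2 s (\<lambda>x. v n x - v m x) \<le> e" for n N e
  proof
    have fat: "gag_nn s (\<lambda>x. v n x - w x) \<le> ennreal (2 / Cs s * e)"
      by (rule fatou[where N = N]) (rule N)
    hence "gag_nn s (\<lambda>x. v n x - w x) < \<infinity>"
      using ennreal_less_top order_le_less_trans by (metis infinity_ennreal_def)
    thus H: "(\<lambda>x. v n x - w x) \<in> Htilde s"
      using wc w0 HtildeD(1,2)[OF v] by (auto simp: Htilde_def intro!: continuous_intros)
    have "0 \<le> e" using N[of N] Hnorm2_nonneg[OF s0 s(2), of "\<lambda>x. v n x - v N x"] by simp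
    hence "2 / Cs s * Hnorm2 s (\<lambda>x. v n x - w x) \<le> 2 / Cs s * e"
      using fat Cs_pos[OF s0 s(2)] unfolding gag_nn_eq_Hnorm2[OF H s0 s(2)]
      by (subst (asm) ennreal_le_iff) auto
    thus "Hnorm2 s (\<lambda>x. v n x - w x) \<le> e"
      using Cs_pos[OF s0 s(2)] by (simp add: divide_simps)
  qed
  \<comment> \<open>One index suffices for membership: \<open>w\<close> is the difference of
    \<open>v N\<close> and \<open>v N - w\<close>.\<close>
  obtain N where "\<And>m. m \<ge> N \<Longrightarrow> Hnorm2 s (\<lambda>x. v N x - v m x) \<le> 1"
    using cauchy[of 1] by auto
  from diff[OF this] have "(\<lambda>x. v N x - w x) \<in> Htilde s" by simp
  from Htilde_diff[OF v[of N] this] have wH: "w \<in> Htilde s" by simp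
  have "(\<lambda>n. Hnorm2 s (\<lambda>x. v n x - w x)) \<longlonglongrightarrow> 0"
  proof (rule LIMSEQ_I)
    fix e :: real assume "0 < e"
    then obtain N where "\<And>m n. m \<ge> N \<Longrightarrow> n \<ge> N \<Longrightarrow> Hnorm2 s (\<lambda>x. v m x - v n x) \<le> e / 2"
      using cauchy[of "e / 2"] by auto
    hence "Hnorm2 s (\<lambda>x. v n x - w x) \<le> e / 2" if "n \<ge> N" for n
      using diff[of N n "e / 2"] that by blast
    hence "Hnorm2 s (\<lambda>x. v n x - w x) < e" if "n \<ge> N" for n
      using that \<open>0 < e\<close> by fastforce
    thus "\<exists>N. \<forall>n\<ge>N. norm (Hnorm2 s (\<lambda>x. v n x - w x) - 0) < e"
      using Hnorm2_nonneg[OF s0 s(2)] \<open>0 < e\<close> by (intro exI[of _ N]) (auto simp: abs_of_nonneg)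
  qed
  with wH lim show ?thesis using that by blast
qed

section \<open>The Riesz representation theorem in a space of functions\<close>

lemma discriminant_le_of_nonneg:
  fixes a b c :: real
  assumes nn: "\<And>t. 0 \<le> a + 2 * b * t + c * t\<^sup>2" and c: "0 \<le> c"
  shows "b\<^sup>2 \<le> a * c"
proof (cases "c = 0")
  case True
  have "b = 0"
  proof (rule ccontr)
    assume "b \<noteq> 0"
    thus False using nn[of "- (a + 1) / (2 * b)"] True by simp
  qed
  thus ?thesis using True by simp
next
  case False
  thus ?thesis using nn[of "- b / c"] c
    by (simp add: power2_eq_square field_simps)
qed

text \<open>The representing element is a limit of approximate minimisers of \<open>B u u - 2 * f u\<close>.\<close>

lemma riesz_function_space:
  fixes V :: "('a \<Rightarrow> real) set" and B :: "('a \<Rightarrow> real) \<Rightarrow> ('a \<Rightarrow> real) \<Rightarrow> real"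
    and f :: "('a \<Rightarrow> real) \<Rightarrow> real"
  assumes zero: "(\<lambda>x. 0) \<in> V"
    and add: "\<And>u v. u \<in> V \<Longrightarrow> v \<in> V \<Longrightarrow> (\<lambda>x. u x + v x) \<in> V"
    and scale: "\<And>u c. u \<in> V \<Longrightarrow> (\<lambda>x. c * u x) \<in> V"
    and B_add: "\<And>u v w. u \<in> V \<Longrightarrow> v \<in> V \<Longrightarrow> w \<in> V \<Longrightarrow> B (\<lambda>x. u x + v x) w = B u w + B v w"
    and B_scale: "\<And>u v c. u \<in> V \<Longrightarrow> v \<in> V \<Longrightarrow> B (\<lambda>x. c * u x) v = c * B u v"
    and B_sym: "\<And>u v. u \<in> V \<Longrightarrow> v \<in> V \<Longrightarrow> B u v = B v u"
    and B_nonneg: "\<And>u. u \<in> V \<Longrightarrow> 0 \<le> B u u"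
    and complete: "\<And>v :: nat \<Rightarrow> 'a \<Rightarrow> real. \<lbrakk>\<And>n. v n \<in> V;
        \<And>e. 0 < e \<Longrightarrow> \<exists>N. \<forall>m\<ge>N. \<forall>n\<ge>N. B (\<lambda>x. v m x - v n x) (\<lambda>x. v m x - v n x) \<le> e\<rbrakk>
        \<Longrightarrow> \<exists>w\<in>V. (\<lambda>n. B (\<lambda>x. v n x - w x) (\<lambda>x. v n x - w x)) \<longlonglongrightarrow> 0"
    and f_add: "\<And>u v. u \<in> V \<Longrightarrow> v \<in> V \<Longrightarrow> f (\<lambda>x. u x + v x) = f u + f v"
    and f_scale: "\<And>u c. u \<in> V \<Longrightarrow> f (\<lambda>x. c * u x) = c * f u"
    and f_bound: "\<And>u. u \<in> V \<Longrightarrow> (f u)\<^sup>2 \<le> C * B u u" and C: "0 \<le> C"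
  obtains u where "u \<in> V" "\<And>v. v \<in> V \<Longrightarrow> B u v = f v"
proof -
  define J where "J u = B u u - 2 * f u" for u
  have B_add2: "B w (\<lambda>x. u x + v x) = B w u + B w v" if "u \<in> V" "v \<in> V" "w \<in> V" for u v w
    using that B_add[OF that] by (simp add: B_sym[of w] add)
  have B_scale2: "B v (\<lambda>x. c * u x) = c * B v u" if "u \<in> V" "v \<in> V" for u v c
    using that B_scale[OF that] by (simp add: B_sym[of v] scale)
  have lin: "(\<lambda>x. u x + t * v x) \<in> V" if "u \<in> V" "v \<in> V" for u v t
    using that by (intro add scale)
  have exp: "B (\<lambda>x. u x + t * v x) (\<lambda>x. u x + t * v x) = B u u + 2 * B u v * t + B v v * t\<^sup>2"
    if "u \<in> V" "v \<in> V" for u v t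
    using that by (simp add: B_add B_add2 B_scale B_scale2 scale lin B_sym[of v u] power2_eq_square algebra_simps)
  have f_lin: "f (\<lambda>x. u x + t * v x) = f u + t * f v" if "u \<in> V" "v \<in> V" for u v t
    using that by (simp add: f_add f_scale scale)
  have diff: "(\<lambda>x. u x - v x) \<in> V" if "u \<in> V" "v \<in> V" for u v
    using lin[OF that, of "-1"] by simp
  have B_diff: "B (\<lambda>x. u x - v x) w = B u w - B v w" if "u \<in> V" "v \<in> V" "w \<in> V" for u v w
    using B_add[OF that(1) scale[OF that(2), of "-1"] that(3)] B_scale[OF that(2,3), of "-1"] by simp
  have CS: "(B u v)\<^sup>2 \<le> B u u * B v v" if "u \<in> V" "v \<in> V" for u v
  proof (rule discriminant_le_of_nonneg)
    show "0 \<le> B u u + 2 * B u v * t + B v v * t\<^sup>2" for t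
      unfolding exp[OF that, symmetric] by (rule B_nonneg[OF lin[OF that]])
  qed (rule B_nonneg[OF that(2)])
  have lower: "- C \<le> J u" if "u \<in> V" for u
  proof -
    have "(f u)\<^sup>2 \<le> ((B u u + C) / 2)\<^sup>2"
      using f_bound[OF that] sum_squares_bound[of C "B u u"]
      by (simp add: power2_eq_square field_simps)
    hence "\<bar>f u\<bar> \<le> (B u u + C) / 2"
      using B_nonneg[OF that] C by (simp flip: abs_le_square_iff)
    thus ?thesis using abs_ge_self[of "f u"] unfolding J_def by (simp add: field_simps)
  qed
  define m where "m = Inf (J ` V)"
  have bdd: "bdd_below (J ` V)" using lower by (auto intro!: bdd_belowI2)
  have m_le: "m \<le> J u" if "u \<in> V" for u
    unfolding m_def using bdd that by (intro cInf_lower) auto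
  have "\<exists>u\<in>V. J u < m + 1 / real (Suc n)" for n
    using cInf_lessD[of "J ` V" "m + 1 / real (Suc n)"] zero by (auto simp: m_def)
  then obtain v where v: "\<And>n. v n \<in> V" "\<And>n. J (v n) < m + 1 / real (Suc n)"
    by metis
  \<comment> \<open>Parallelogram identity: the left side equals \<open>2 * J u + 2 * J w\<close>
    minus four times \<open>J\<close> at the midpoint, where \<open>J\<close> is at least
    \<open>m\<close>. It makes the minimising sequence Cauchy.\<close>
  have par: "B (\<lambda>x. u x - w x) (\<lambda>x. u x - w x) \<le> 2 * (J u - m) + 2 * (J w - m)"
    if "u \<in> V" "w \<in> V" for u w
  proof -
    have u2: "(\<lambda>x. 1/2 * u x) \<in> V" using that by (intro scale)
    have "J (\<lambda>x. 1/2 * u x + 1/2 * w x) =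
        1/4 * B u u + 1/2 * B u w + 1/4 * B w w - f u - f w"
      unfolding J_def exp[OF u2 that(2)] f_lin[OF u2 that(2)]
        B_scale[OF that(1) u2] B_scale[OF that] B_scale2[OF that(1,1)] f_scale[OF that(1)]
      by (simp add: power2_eq_square)
    moreover have "m \<le> J (\<lambda>x. 1/2 * u x + 1/2 * w x)" by (rule m_le[OF lin[OF u2 that(2)]])
    moreover have "B (\<lambda>x. u x - w x) (\<lambda>x. u x - w x) = B u u - 2 * B u w + B w w"
      using exp[OF that, of "-1"] by simp
    ultimately show ?thesis by (simp add: J_def)
  qed
  have "\<exists>w\<in>V. (\<lambda>n. B (\<lambda>x. v n x - w x) (\<lambda>x. v n x - w x)) \<longlonglongrightarrow> 0"
  proof (rule complete[OF v(1)])
    fix e :: real assume "0 < e"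
    then obtain N where N: "1 / real (Suc N) < e / 4"
      using nat_approx_posE[of "e / 4"] by auto
    show "\<exists>N. \<forall>m\<ge>N. \<forall>n\<ge>N. B (\<lambda>x. v m x - v n x) (\<lambda>x. v m x - v n x) \<le> e"
    proof (intro exI allI impI)
      fix i j assume "N \<le> i" "N \<le> j"
      hence "1 / real (Suc i) \<le> 1 / real (Suc N)" "1 / real (Suc j) \<le> 1 / real (Suc N)"
        by (auto simp: field_simps)
      thus "B (\<lambda>x. v i x - v j x) (\<lambda>x. v i x - v j x) \<le> e"
        using par[OF v(1) v(1), of i j] v(2)[of i] v(2)[of j] N by argo
    qed
  qed
  then obtain w where w: "w \<in> V" "(\<lambda>n. B (\<lambda>x. v n x - w x) (\<lambda>x. v n x - w x)) \<longlonglongrightarrow> 0"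
    by blast
  have "B w z = f z" if z: "z \<in> V" for z
  proof -
    have "(\<lambda>n. (B (\<lambda>x. v n x - w x) z)\<^sup>2) \<longlonglongrightarrow> 0"
    proof (rule tendsto_sandwich[OF _ _ tendsto_const])
      show "\<forall>\<^sub>F n in sequentially. (B (\<lambda>x. v n x - w x) z)\<^sup>2 \<le> B (\<lambda>x. v n x - w x) (\<lambda>x. v n x - w x) * B z z"
        using CS[OF diff[OF v(1) w(1)] z] by simp
      show "(\<lambda>n. B (\<lambda>x. v n x - w x) (\<lambda>x. v n x - w x) * B z z) \<longlonglongrightarrow> 0"
        using tendsto_mult_left_zero[OF w(2)] by simp
    qed simp
    hence "(\<lambda>n. B (\<lambda>x. v n x - w x) z) \<longlonglongrightarrow> 0" by simp
    hence "(\<lambda>n. B (v n) z - B w z) \<longlonglongrightarrow> 0" using B_diff[OF v(1) w(1) z] by simp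
    hence Bl: "(\<lambda>n. B (v n) z) \<longlonglongrightarrow> B w z" by (simp add: LIM_zero_iff)
    \<comment> \<open>Minimality survives in the limit: \<open>J\<close> at
      \<open>v n + t * z\<close> is at least \<open>m\<close>, while
      \<open>J (v n) < m + 1 / (n + 1)\<close>. A quadratic in \<open>t\<close> that is nowhere
      negative and has constant term 0 must have zero linear coefficient.\<close>
    have "0 \<le> 0 + 2 * (B w z - f z) * t + B z z * t\<^sup>2" for t
    proof (rule LIMSEQ_le_const)
      show "(\<lambda>n. inverse (real (Suc n)) + 2 * (B (v n) z - f z) * t + B z z * t\<^sup>2)
          \<longlonglongrightarrow> 0 + 2 * (B w z - f z) * t + B z z * t\<^sup>2"
        by (intro tendsto_intros Bl LIMSEQ_inverse_real_of_nat)
      have "0 \<le> inverse (real (Suc n)) + 2 * (B (v n) z - f z) * t + B z z * t\<^sup>2" for n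
        using m_le[OF lin[OF v(1) z, of n t]] v(2)[of n]
        unfolding J_def exp[OF v(1) z] f_lin[OF v(1) z]
        by (simp add: algebra_simps inverse_eq_divide)
      thus "\<exists>N. \<forall>n\<ge>N. 0 \<le> inverse (real (Suc n)) + 2 * (B (v n) z - f z) * t + B z z * t\<^sup>2"
        by blast
    qed
    from discriminant_le_of_nonneg[OF this B_nonneg[OF z]] show ?thesis by simp
  qed
  with w(1) show ?thesis by (rule that)
qed

section \<open>Reflection at the interface\<close>

text \<open>This is what \<open>Top\<close> does to functions vanishing at \<open>b\<close>. The
  default 0 at \<open>b\<close> and outside \<open>I\<close> agrees with the values of such
  functions in \<open>Htilde\<close>.\<close>

definition refl_at :: "real \<Rightarrow> (real \<Rightarrow> real) \<Rightarrow> real \<Rightarrow> real" where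
  "refl_at b v x = (if x \<in> I1 b then 1 else if x \<in> I2 b then -1 else 0) * v x"

lemma refl_at_eq:
  assumes "0 < b" "b < 1" "\<And>x. x \<notin> I0 \<Longrightarrow> v x = 0" "v b = 0"
  shows "refl_at b v x = (if x \<le> b then v x else - v x)"
  using assms by (cases "x = b") (auto simp: refl_at_def I0_def I1_def I2_def)

lemma refl_at_refl_at:
  assumes "0 < b" "b < 1" "\<And>x. x \<notin> I0 \<Longrightarrow> v x = 0" "v b = 0"
  shows "refl_at b (refl_at b v) = v"
proof
  have "refl_at b (refl_at b v) x = (if x \<le> b then refl_at b v x else - refl_at b v x)" for x
    by (rule refl_at_eq) (use assms in \<open>auto simp: refl_at_def\<close>)
  thus "refl_at b (refl_at b v) x = v x" for x by (simp add: refl_at_eq[where b = b and v = v, OF assms])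
qed

lemma refl_at_lin:
  "refl_at b (\<lambda>x. u x + v x) = (\<lambda>x. refl_at b u x + refl_at b v x)"
  "refl_at b (\<lambda>x. c * u x) = (\<lambda>x. c * refl_at b u x)"
  by (auto simp: refl_at_def algebra_simps)

text \<open>Differences between points on the same side of \<open>b\<close> change at most their
  sign, so only the interaction across \<open>b\<close> can grow, and the splitting estimate
  controls it. The doubled right-hand side bounds each half by the whole.\<close>

lemma refl_at_gag_nn_le:
  assumes s: "1/2 < s" and b: "0 < b" "b < 1" and v: "v \<in> Htilde s" "v b = 0"
  shows "continuous_on UNIV (refl_at b v)"
    "gag_nn s (refl_at b v) \<le> ennreal (split_const s) * (gag_nn s v + gag_nn s v)"
proof -
  note eq = refl_at_eq[where b = b and v = v, OF b HtildeD(2)[OF v(1)] v(2)]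
  \<comment> \<open>A formula without cases, of which one term is always \<open>v b = 0\<close>;
    continuity is then immediate.\<close>
  have "refl_at b v = (\<lambda>x. v (min x b) - v (max x b))"
    using v(2) by (auto simp: eq min_def max_def)
  thus c: "continuous_on UNIV (refl_at b v)"
    by (auto intro!: continuous_intros continuous_on_compose2[OF HtildeD(1)[OF v(1)]])
  have "gag_nn s (refl_at b v) \<le> ennreal (split_const s) *
      (gag_on s {..<b} (refl_at b v) + gag_on s {b<..} (refl_at b v))"
    by (rule gag_nn_le_split[OF s c]) (simp add: eq v)
  also have "gag_on s {..<b} (refl_at b v) = gag_on s {..<b} v"
    unfolding gag_on_def by (intro nn_integral_cong) (auto simp: eq indicator_def)
  also have "gag_on s {b<..} (refl_at b v) = gag_on s {b<..} v"
    unfolding gag_on_def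
    by (intro nn_integral_cong) (auto simp: eq indicator_def power2_commute)
  also have "ennreal (split_const s) * (gag_on s {..<b} v + gag_on s {b<..} v)
     \<le> ennreal (split_const s) * (gag_nn s v + gag_nn s v)"
    by (intro mult_left_mono add_mono gag_on_le_gag_nn HtildeD(3)[OF v(1)]) auto
  finally show "gag_nn s (refl_at b v) \<le> ennreal (split_const s) * (gag_nn s v + gag_nn s v)" .
qed

lemma refl_at_Htilde:
  assumes s: "1/2 < s" "s < 1" and b: "0 < b" "b < 1" and v: "v \<in> Htilde s" "v b = 0"
  shows "refl_at b v \<in> Htilde s" "Hnorm2 s (refl_at b v) \<le> 2 * split_const s * Hnorm2 s v"
proof -
  have s0: "0 < s" using s by simp
  define X where "X = 2 / Cs s * Hnorm2 s v"
  have pos: "0 \<le> X" "0 < split_const s" "0 < Cs s"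
    using Cs_pos[OF s0 s(2)] Hnorm2_nonneg[OF s0 s(2), of v] split_const_pos[OF s0] by (auto simp: X_def)
  note r = refl_at_gag_nn_le[OF s(1) b v]
  have le: "gag_nn s (refl_at b v) \<le> ennreal (split_const s * (2 * X))"
  proof -
    have "gag_nn s v + gag_nn s v = ennreal (2 * X)"
      using pos(1) by (simp add: gag_nn_eq_Hnorm2[OF v(1) s0 s(2)] X_def flip: ennreal_plus)
    thus ?thesis using r(2) pos by (simp only: ennreal_mult')
  qed
  hence "gag_nn s (refl_at b v) < \<infinity>"
    using ennreal_less_top order_le_less_trans by (metis infinity_ennreal_def)
  thus H: "refl_at b v \<in> Htilde s"
    using r(1) HtildeD(2)[OF v(1)] by (auto simp: Htilde_def refl_at_def)
  have "2 / Cs s * Hnorm2 s (refl_at b v) \<le> split_const s * (2 * X)"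
    using le pos unfolding gag_nn_eq_Hnorm2[OF H s0 s(2)] by (subst (asm) ennreal_le_iff) auto
  thus "Hnorm2 s (refl_at b v) \<le> 2 * split_const s * Hnorm2 s v"
    using pos(3) by (simp add: X_def field_simps)
qed

text \<open>The integrands agree pair by pair. Within \<open>I2\<close>, and between
  \<open>I2\<close> and the exterior where \<open>v\<close> vanishes, reflection flips the
  difference and \<open>\<sigma>2\<close> absorbs the sign. Between \<open>I1\<close> and
  \<open>I2\<close> the difference would become a sum, but there the coefficient is 0.\<close>

lemma aform_refl_at:
  assumes "\<And>x. x \<notin> I0 \<Longrightarrow> v x = 0"
  shows "aform s (sigma_coef b \<sigma>1 \<sigma>2 0) u (refl_at b v) = aform s (sigma_coef b \<sigma>1 (- \<sigma>2) 0) u v"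
proof -
  have "sigma_coef b \<sigma>1 \<sigma>2 0 x y * (refl_at b v x - refl_at b v y) =
      sigma_coef b \<sigma>1 (- \<sigma>2) 0 x y * (v x - v y)" for x y
  proof -
    have d: "z \<notin> I1 b" if "z \<in> I2 b" for z using that by (simp add: I1_def I2_def)
    show ?thesis
      by (cases "x \<in> I1 b"; cases "x \<in> I2 b"; cases "y \<in> I1 b"; cases "y \<in> I2 b"; cases "x \<in> I0"; cases "y \<in> I0")
         (simp_all add: sigma_coef_def refl_at_def d assms algebra_simps)
  qed
  hence "sigma_coef b \<sigma>1 \<sigma>2 0 x y * a * (refl_at b v x - refl_at b v y) =
      sigma_coef b \<sigma>1 (- \<sigma>2) 0 x y * a * (v x - v y)" for x y a
    by (metis (no_types, opaque_lifting) mult.assoc mult.commute)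
  thus ?thesis unfolding aform_def by (simp only:)
qed

lemma coef_bound_sigma_coef: "coef_bound (sigma_coef b \<sigma>1 \<sigma>2 \<sigma>3) (\<bar>\<sigma>1\<bar> + \<bar>\<sigma>2\<bar> + \<bar>\<sigma>3\<bar>)"
proof -
  have "(\<lambda>p. sigma_coef b \<sigma>1 \<sigma>2 \<sigma>3 (fst p) (snd p)) \<in> borel_measurable (lborel \<Otimes>\<^sub>M lborel)"
    unfolding sigma_coef_def I0_def I1_def I2_def by measurable
  thus ?thesis by (auto simp: coef_bound_def sigma_coef_def)
qed

text \<open>The form dominates the integrals over pairs on the same side of \<open>b\<close>; the
  splitting estimate recovers from these the pairs that the form does not see.\<close>

lemma sigma_coef_coercive:
  assumes s: "1/2 < s" "s < 1" and b: "0 < b" "b < 1" and \<tau>: "0 < \<tau>1" "0 < \<tau>2"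
    and v: "v \<in> Htilde s" "v b = 0"
  shows "min \<tau>1 \<tau>2 * Hnorm2 s v \<le> split_const s * aform s (sigma_coef b \<tau>1 \<tau>2 0) v v"
proof -
  have s0: "0 < s" using s by simp
  define m where "m = min \<tau>1 \<tau>2"
  have m: "0 < m" "m \<le> \<tau>1" "m \<le> \<tau>2" using \<tau> by (auto simp: m_def)
  let ?\<tau> = "sigma_coef b \<tau>1 \<tau>2 0"
  define A where "A = 2 / Cs s * aform s ?\<tau> v v"
  have C: "0 < Cs s" using Cs_pos[OF s0 s(2)] .
  have [measurable]: "v \<in> borel_measurable borel" by (rule HtildeD(3)[OF v(1)])
  have cm: "(\<lambda>p. ?\<tau> (fst p) (snd p)) \<in> borel_measurable (lborel \<Otimes>\<^sub>M lborel)"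
    using coef_bound_sigma_coef[of b \<tau>1 \<tau>2 0] by (simp add: coef_bound_def)
  have \<tau>nn: "0 \<le> ?\<tau> x y" for x y using \<tau> by (simp add: sigma_coef_def)
  have nn: "0 \<le> ?\<tau> x y * (v x - v y) * (v x - v y) * kern s x y" for x y
    using mult_nonneg_nonneg[OF mult_nonneg_nonneg[OF \<tau>nn zero_le_square[of "v x - v y"]] kern_nonneg]
    by (simp only: mult.assoc)
  define F where "F J x y = ennreal (indicator J x * indicator J y * (v x - v y)\<^sup>2 * kern s x y)" for J x y
  have [measurable]: "(\<lambda>(x, y). F {..<b} x y) \<in> borel_measurable (lborel \<Otimes>\<^sub>M lborel)"
      "(\<lambda>(x, y). F {b<..} x y) \<in> borel_measurable (lborel \<Otimes>\<^sub>M lborel)"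
    unfolding F_def by measurable
  have "ennreal m * (gag_on s {..<b} v + gag_on s {b<..} v)
      = (\<integral>\<^sup>+x. \<integral>\<^sup>+y. ennreal m * (F {..<b} x y + F {b<..} x y) \<partial>lborel \<partial>lborel)"
    unfolding gag_on_def F_def[symmetric] by (simp add: nn_integral_add nn_integral_cmult)
  also have "\<dots> \<le> (\<integral>\<^sup>+x. \<integral>\<^sup>+y. ennreal (?\<tau> x y * (v x - v y) * (v x - v y) * kern s x y) \<partial>lborel \<partial>lborel)"
  proof (intro nn_integral_mono)
    fix x y :: real
    have key: "m * ((indicator {..<b} x * indicator {..<b} y + indicator {b<..} x * indicator {b<..} y) * (v x - v y)\<^sup>2)
        \<le> ?\<tau> x y * (v x - v y)\<^sup>2"
    proof (cases "v x = v y")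
      case False
      \<comment> \<open>For two exterior points the coefficient is 0, but then \<open>v\<close>
        takes the same value at both.\<close>
      hence "\<not> (x \<notin> I0 \<and> y \<notin> I0)" using HtildeD(2)[OF v(1)] by metis
      hence "m * (indicator {..<b} x * indicator {..<b} y + indicator {b<..} x * indicator {b<..} y) \<le> ?\<tau> x y"
      proof -
        have "z \<in> I1 b \<longleftrightarrow> z \<in> I0 \<and> z < b" "z \<in> I2 b \<longleftrightarrow> z \<in> I0 \<and> b < z" for z
          using b by (auto simp: I0_def I1_def I2_def)
        thus ?thesis using m \<tau> \<open>\<not> (x \<notin> I0 \<and> y \<notin> I0)\<close>
          by (cases "x \<in> I0"; cases "y \<in> I0"; cases x b rule: linorder_cases; cases y b rule: linorder_cases)
             (simp_all add: sigma_coef_def)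
      qed
      from mult_right_mono[OF this, of "(v x - v y)\<^sup>2"] show ?thesis by (simp add: mult.assoc)
    qed simp
    have "ennreal m * (F {..<b} x y + F {b<..} x y) =
       ennreal (m * ((indicator {..<b} x * indicator {..<b} y + indicator {b<..} x * indicator {b<..} y) * (v x - v y)\<^sup>2) * kern s x y)"
      unfolding F_def using m(1) by (simp add: algebra_simps flip: ennreal_plus ennreal_mult)
    also have "\<dots> \<le> ennreal (?\<tau> x y * (v x - v y)\<^sup>2 * kern s x y)"
      by (intro ennreal_leI mult_right_mono key) simp
    finally show "ennreal m * (F {..<b} x y + F {b<..} x y) \<le> ennreal (?\<tau> x y * (v x - v y) * (v x - v y) * kern s x y)"
      by (simp add: power2_eq_square mult.assoc)
  qed
  also have "\<dots> = (\<integral>\<^sup>+p. ennreal (?\<tau> (fst p) (snd p) * (v (fst p) - v (snd p)) * (v (fst p) - v (snd p))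
      * kern s (fst p) (snd p)) \<partial>(lborel \<Otimes>\<^sub>M lborel))"
    using cm by (subst lborel.nn_integral_fst[symmetric]) auto
  also have "\<dots> = ennreal A"
    using aform_integrable[OF coef_bound_sigma_coef v(1) v(1), of b \<tau>1 \<tau>2 0] nn C
    by (subst nn_integral_eq_integral) (auto simp: A_def aform_def)
  finally have 1: "ennreal m * (gag_on s {..<b} v + gag_on s {b<..} v) \<le> ennreal A" .
  have A0: "0 \<le> A"
    unfolding A_def aform_def using C nn
    by (intro mult_nonneg_nonneg integral_nonneg_AE) auto
  have "ennreal (m * (2 / Cs s * Hnorm2 s v)) = ennreal m * gag_nn s v"
    using m(1) by (simp only: gag_nn_eq_Hnorm2[OF v(1) s0 s(2)] ennreal_mult')
  also have "\<dots> \<le> ennreal m * (ennreal (split_const s) * (gag_on s {..<b} v + gag_on s {b<..} v))"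
    by (intro mult_left_mono gag_nn_le_split[OF s(1) HtildeD(1)[OF v(1)] v(2)]) simp
  also have "\<dots> = ennreal (split_const s) * (ennreal m * (gag_on s {..<b} v + gag_on s {b<..} v))"
    by (simp add: mult.left_commute)
  also have "\<dots> \<le> ennreal (split_const s) * ennreal A"
    by (intro mult_left_mono 1) simp
  also have "\<dots> = ennreal (split_const s * A)"
    using A0 split_const_pos[OF s0] by (simp add: ennreal_mult)
  finally have "m * (2 / Cs s * Hnorm2 s v) \<le> split_const s * A"
    using A0 split_const_pos[OF s0] by (subst (asm) ennreal_le_iff) auto
  thus ?thesis using C by (simp add: A_def m_def field_simps)
qed

section \<open>The Fredholm property\<close>

lemma Htilde_point_zero_complete:
  fixes v :: "nat \<Rightarrow> real \<Rightarrow> real"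
  assumes s: "1/2 < s" "s < 1" and v: "\<And>n. v n \<in> Htilde s" "\<And>n. v n b = 0"
    and cauchy: "\<And>e. 0 < e \<Longrightarrow> \<exists>N. \<forall>m\<ge>N. \<forall>n\<ge>N. Hnorm2 s (\<lambda>x. v m x - v n x) \<le> e"
  obtains w where "w \<in> Htilde s" "w b = 0" "(\<lambda>n. Hnorm2 s (\<lambda>x. v n x - w x)) \<longlonglongrightarrow> 0"
proof -
  obtain w where w: "w \<in> Htilde s" "(\<lambda>n. Hnorm2 s (\<lambda>x. v n x - w x)) \<longlonglongrightarrow> 0"
    "\<And>x. (\<lambda>n. v n x) \<longlonglongrightarrow> w x"
    using Htilde_complete[OF s v(1) cauchy] by metis
  have "w b = 0" using w(3)[of b] v(2) by (simp add: LIMSEQ_const_iff)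
  with w show ?thesis using that by blast
qed

text \<open>On the hyperplane the positive form is equivalent to the squared norm: coercivity
  carries Cauchy sequences from the form to the norm, and boundedness carries their convergence
  back.\<close>

lemma riesz_point_zero:
  fixes f :: "(real \<Rightarrow> real) \<Rightarrow> real"
  assumes s: "1/2 < s" "s < 1" and b: "0 < b" "b < 1" and \<tau>: "0 < \<tau>1" "0 < \<tau>2"
    and f_add: "\<And>u v. u \<in> Htilde s \<Longrightarrow> v \<in> Htilde s \<Longrightarrow> u b = 0 \<Longrightarrow> v b = 0 \<Longrightarrow>
        f (\<lambda>x. u x + v x) = f u + f v"
    and f_scale: "\<And>u c. u \<in> Htilde s \<Longrightarrow> u b = 0 \<Longrightarrow> f (\<lambda>x. c * u x) = c * f u"
    and f_bound: "\<And>u. u \<in> Htilde s \<Longrightarrow> u b = 0 \<Longrightarrow> (f u)\<^sup>2 \<le> C * Hnorm2 s u" and C: "0 \<le> C"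
  obtains u where "u \<in> Htilde s" "u b = 0"
    "\<And>v. v \<in> Htilde s \<Longrightarrow> v b = 0 \<Longrightarrow> aform s (sigma_coef b \<tau>1 \<tau>2 0) u v = f v"
proof -
  have s0: "0 < s" using s by simp
  define V where "V = {v \<in> Htilde s. v b = 0}"
  define \<tau>' where "\<tau>' = sigma_coef b \<tau>1 \<tau>2 0"
  define L where "L = split_const s / min \<tau>1 \<tau>2"
  define M where "M = \<bar>\<tau>1\<bar> + \<bar>\<tau>2\<bar> + \<bar>0::real\<bar>"
  have cb: "coef_bound \<tau>' M"
    unfolding \<tau>'_def M_def by (rule coef_bound_sigma_coef)
  have pos: "0 < L" "0 < M" using \<tau> split_const_pos[OF s0] by (auto simp: L_def M_def)
  have co: "Hnorm2 s v \<le> L * aform s \<tau>' v v" if "v \<in> V" for v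
    using sigma_coef_coercive[OF s b \<tau>, of v] that \<tau>
    by (simp add: V_def \<tau>'_def L_def pos_le_divide_eq mult.commute)
  have diff: "(\<lambda>x. u x - v x) \<in> V" if "u \<in> V" "v \<in> V" for u v
    using that by (auto simp: V_def Htilde_diff)
  obtain u where u: "u \<in> V" "\<And>v. v \<in> V \<Longrightarrow> aform s \<tau>' u v = f v"
  proof (rule riesz_function_space[of V "aform s \<tau>'" f "C * L"])
    show "aform s \<tau>' u u \<ge> 0" if "u \<in> V" for u
      using order_trans[OF Hnorm2_nonneg[OF s0 s(2)] co[OF that]] pos by (simp add: zero_le_mult_iff)
    show "(f u)\<^sup>2 \<le> C * L * aform s \<tau>' u u" if "u \<in> V" for u
      using f_bound[of u] that mult_left_mono[OF co[OF that] C] by (simp add: V_def mult.assoc)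
    show "aform s \<tau>' (\<lambda>x. u x + v x) w = aform s \<tau>' u w + aform s \<tau>' v w"
      if "u \<in> V" "v \<in> V" "w \<in> V" for u v w
      using that by (intro aform_add_left[OF cb]) (auto simp: V_def)
    fix v :: "nat \<Rightarrow> real \<Rightarrow> real"
    assume v: "\<And>n. v n \<in> V" and cauchy: "\<And>e. 0 < e \<Longrightarrow>
      \<exists>N. \<forall>m\<ge>N. \<forall>n\<ge>N. aform s \<tau>' (\<lambda>x. v m x - v n x) (\<lambda>x. v m x - v n x) \<le> e"
    have v': "v n \<in> Htilde s" "v n b = 0" for n using v[of n] by (auto simp: V_def)
    have cauchy': "\<exists>N. \<forall>m\<ge>N. \<forall>n\<ge>N. Hnorm2 s (\<lambda>x. v m x - v n x) \<le> e" if e: "0 < e" for e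
    proof -
      obtain N where N: "\<And>m n. m \<ge> N \<Longrightarrow> n \<ge> N \<Longrightarrow>
          aform s \<tau>' (\<lambda>x. v m x - v n x) (\<lambda>x. v m x - v n x) \<le> e / L"
        using cauchy[OF divide_pos_pos[OF e pos(1)]] by blast
      show ?thesis
      proof (intro exI allI impI)
        fix m n assume "N \<le> m" "N \<le> n"
        thus "Hnorm2 s (\<lambda>x. v m x - v n x) \<le> e"
          using co[OF diff[OF v v], of m n] mult_left_mono[OF N[of m n], of L] pos by simp
      qed
    qed
    obtain w where w: "w \<in> Htilde s" "w b = 0" "(\<lambda>n. Hnorm2 s (\<lambda>x. v n x - w x)) \<longlonglongrightarrow> 0"
      by (rule Htilde_point_zero_complete[OF s v' cauchy'])
    have wV: "w \<in> V" using w by (simp add: V_def)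
    have "(\<lambda>n. aform s \<tau>' (\<lambda>x. v n x - w x) (\<lambda>x. v n x - w x)) \<longlonglongrightarrow> 0"
    proof (rule tendsto_sandwich[OF _ _ tendsto_const])
      show "\<forall>\<^sub>F n in sequentially. 0 \<le> aform s \<tau>' (\<lambda>x. v n x - w x) (\<lambda>x. v n x - w x)"
        using order_trans[OF Hnorm2_nonneg[OF s0 s(2)] co[OF diff[OF v wV]]] pos
        by (simp add: zero_le_mult_iff)
      show "\<forall>\<^sub>F n in sequentially. aform s \<tau>' (\<lambda>x. v n x - w x) (\<lambda>x. v n x - w x)
          \<le> M * Hnorm2 s (\<lambda>x. v n x - w x)"
      proof (rule always_eventually, rule allI)
        fix n
        have "(\<lambda>x. v n x - w x) \<in> Htilde s" using v'(1) w(1) by (rule Htilde_diff)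
        thus "aform s \<tau>' (\<lambda>x. v n x - w x) (\<lambda>x. v n x - w x) \<le> M * Hnorm2 s (\<lambda>x. v n x - w x)"
          using abs_aform_le_Hnorm2[OF s0 s(2) cb, of "\<lambda>x. v n x - w x" "\<lambda>x. v n x - w x"] by simp
      qed
      show "(\<lambda>n. M * Hnorm2 s (\<lambda>x. v n x - w x)) \<longlonglongrightarrow> 0"
        using tendsto_mult_right_zero[OF w(3)] by simp
    qed
    with wV show "\<exists>w\<in>V. (\<lambda>n. aform s \<tau>' (\<lambda>x. v n x - w x) (\<lambda>x. v n x - w x)) \<longlonglongrightarrow> 0" by blast
  qed (use C pos f_add f_scale in \<open>auto simp: V_def Htilde_zero Htilde_add Htilde_scale aform_scale_left
        intro: aform_commute\<close>)
  show ?thesis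
  proof
    show "u \<in> Htilde s" "u b = 0" using u(1) by (auto simp: V_def)
    show "aform s (sigma_coef b \<tau>1 \<tau>2 0) u v = f v" if "v \<in> Htilde s" "v b = 0" for v
      using u(2)[of v] that by (simp add: V_def \<tau>'_def)
  qed
qed

section \<open>Functionals and the dual norm\<close>

lemma HdualI:
  assumes "\<And>v. v \<notin> Htilde s \<Longrightarrow> f v = 0"
    and "\<And>u v. u \<in> Htilde s \<Longrightarrow> v \<in> Htilde s \<Longrightarrow> f (\<lambda>x. u x + v x) = f u + f v"
    and "\<And>u c. u \<in> Htilde s \<Longrightarrow> f (\<lambda>x. c * u x) = c * f u"
    and "\<And>v. v \<in> Htilde s \<Longrightarrow> \<bar>f v\<bar> \<le> C * Hnorm s v"
  shows "f \<in> Hdual s"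
  using assms unfolding Hdual_def by blast

lemma HdualD:
  assumes "f \<in> Hdual s"
  shows "v \<notin> Htilde s \<Longrightarrow> f v = 0"
    "u \<in> Htilde s \<Longrightarrow> v \<in> Htilde s \<Longrightarrow> f (\<lambda>x. u x + v x) = f u + f v"
    "u \<in> Htilde s \<Longrightarrow> f (\<lambda>x. c * u x) = c * f u"
  using assms unfolding Hdual_def by blast+

lemma Hdual_bound:
  assumes f: "f \<in> Hdual s" and s: "0 < s" "s < 1"
  obtains C where "0 \<le> C" "\<And>v. v \<in> Htilde s \<Longrightarrow> \<bar>f v\<bar> \<le> C * Hnorm s v"
proof -
  obtain C where C: "\<And>v. v \<in> Htilde s \<Longrightarrow> \<bar>f v\<bar> \<le> C * Hnorm s v"
    using f unfolding Hdual_def by blast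
  have "\<bar>f v\<bar> \<le> \<bar>C\<bar> * Hnorm s v" if "v \<in> Htilde s" for v
    using C[OF that] mult_right_mono[OF abs_ge_self Hnorm_nonneg[OF s, of v], of C] by linarith
  thus ?thesis using that[of "\<bar>C\<bar>"] by simp
qed

lemma Hdual_diff:
  assumes f: "f \<in> Hdual s" and g: "g \<in> Hdual s" and s: "0 < s" "s < 1"
  shows "(\<lambda>v. f v - g v) \<in> Hdual s"
proof -
  obtain C D where "\<And>v. v \<in> Htilde s \<Longrightarrow> \<bar>f v\<bar> \<le> C * Hnorm s v"
      "\<And>v. v \<in> Htilde s \<Longrightarrow> \<bar>g v\<bar> \<le> D * Hnorm s v"
    using Hdual_bound[OF f s] Hdual_bound[OF g s] by metis
  hence "\<bar>f v - g v\<bar> \<le> (C + D) * Hnorm s v" if "v \<in> Htilde s" for v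
    using that by (smt (verit) distrib_right)
  thus ?thesis
    by (intro HdualI[where C = "C + D"]) (auto simp: HdualD[OF f] HdualD[OF g] algebra_simps)
qed

lemma Hdual_scale:
  assumes f: "f \<in> Hdual s" and s: "0 < s" "s < 1"
  shows "(\<lambda>v. c * f v) \<in> Hdual s"
proof -
  obtain C where C: "\<And>v. v \<in> Htilde s \<Longrightarrow> \<bar>f v\<bar> \<le> C * Hnorm s v"
    using Hdual_bound[OF f s] by metis
  have "\<bar>c * f v\<bar> \<le> \<bar>c\<bar> * C * Hnorm s v" if "v \<in> Htilde s" for v
    using mult_left_mono[OF C[OF that], of "\<bar>c\<bar>"] by (simp add: abs_mult mult.assoc)
  thus ?thesis
    by (intro HdualI[where C = "\<bar>c\<bar> * C"]) (auto simp: HdualD[OF f] algebra_simps)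
qed

lemma abs_le_dual_norm:
  assumes f: "f \<in> Hdual s" and s: "1/2 < s" "s < 1" and v: "v \<in> Htilde s"
  shows "\<bar>f v\<bar> \<le> dual_norm s f * Hnorm s v"
proof (cases "v = (\<lambda>x. 0)")
  case True
  thus ?thesis using HdualD(3)[OF f Htilde_zero, of 0] by (simp add: Hnorm_zero)
next
  case False
  have s0: "0 < s" using s by simp
  obtain C where C: "\<And>v. v \<in> Htilde s \<Longrightarrow> \<bar>f v\<bar> \<le> C * Hnorm s v"
    using Hdual_bound[OF f s0 s(2)] by metis
  have "bdd_above ((\<lambda>v. \<bar>f v\<bar> / Hnorm s v) ` (Htilde s - {\<lambda>x. 0}))"
    using C Hnorm_pos[OF s] by (intro bdd_aboveI2[of _ _ C]) (auto simp: pos_divide_le_eq)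
  hence "\<bar>f v\<bar> / Hnorm s v \<le> dual_norm s f"
    unfolding dual_norm_def using v False by (intro cSUP_upper) auto
  thus ?thesis using Hnorm_pos[OF s v False] by (simp add: pos_divide_le_eq)
qed

text \<open>A real-valued supremum inherits the bound \<open>C\<close> from its members only over a
  nonempty index set; \<open>\<psi>\<close> supplies a member.\<close>

lemma dual_norm_le:
  assumes s: "1/2 < s" "s < 1" and ne: "\<psi> \<in> Htilde s" "\<psi> \<noteq> (\<lambda>x. 0)"
    and C: "\<And>v. v \<in> Htilde s \<Longrightarrow> \<bar>f v\<bar> \<le> C * Hnorm s v"
  shows "dual_norm s f \<le> C"
  unfolding dual_norm_def
  using ne C Hnorm_pos[OF s] by (intro cSUP_least) (auto simp: pos_divide_le_eq)

lemma Aop_Hdual: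
  assumes s: "1/2 < s" "s < 1" and \<sigma>: "coef_bound \<sigma> M" and u: "u \<in> Htilde s"
  shows "Aop s \<sigma> u \<in> Hdual s"
proof -
  have "\<bar>Aop s \<sigma> u v\<bar> \<le> (M * Hnorm s u) * Hnorm s v" if "v \<in> Htilde s" for v
    using abs_aform_le_Hnorm[OF s \<sigma> u that] that by (simp add: Aop_def)
  thus ?thesis
    by (intro HdualI[where C = "M * Hnorm s u"])
       (auto simp: Aop_def Htilde_add Htilde_scale aform_scale_right aform_add_right[OF \<sigma> _ _ u])
qed

lemma square_le_Hnorm2_of_abs_le_Hnorm:
  assumes "0 < s" "s < 1" "0 \<le> C" "\<bar>a\<bar> \<le> C * Hnorm s u"
  shows "a\<^sup>2 \<le> C\<^sup>2 * Hnorm2 s u"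
  using power_mono[OF assms(4), of 2] assms(1-3) by (simp add: power_mult_distrib Hnorm_square)

text \<open>Reflection is a bijection of \<open>{v. v b = 0}\<close>, so testing the sign-changing
  form with \<open>v\<close> amounts to testing the positive form with the reflected
  \<open>v\<close>. The datum is reflected accordingly, the solution \<open>u\<close> is
  not.\<close>

lemma solve_point_zero:
  fixes f :: "(real \<Rightarrow> real) \<Rightarrow> real"
  assumes s: "1/2 < s" "s < 1" and b: "0 < b" "b < 1" and \<sigma>: "0 < \<sigma>1" "\<sigma>2 < 0"
    and f: "f \<in> Hdual s"
  obtains u where "u \<in> Htilde s" "u b = 0"
    "\<And>v. v \<in> Htilde s \<Longrightarrow> v b = 0 \<Longrightarrow> aform s (sigma_coef b \<sigma>1 \<sigma>2 0) u v = f v"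
proof -
  have s0: "0 < s" using s by simp
  obtain C where C: "0 \<le> C" "\<And>v. v \<in> Htilde s \<Longrightarrow> \<bar>f v\<bar> \<le> C * Hnorm s v"
    using Hdual_bound[OF f s0 s(2)] by metis
  have bd: "(f (refl_at b u))\<^sup>2 \<le> C\<^sup>2 * (2 * split_const s) * Hnorm2 s u"
    if u: "u \<in> Htilde s" "u b = 0" for u
  proof -
    have "(f (refl_at b u))\<^sup>2 \<le> C\<^sup>2 * Hnorm2 s (refl_at b u)"
      using C refl_at_Htilde(1)[OF s b u] by (intro square_le_Hnorm2_of_abs_le_Hnorm[OF s0 s(2)])
    also have "\<dots> \<le> C\<^sup>2 * (2 * split_const s * Hnorm2 s u)"
      by (intro mult_left_mono refl_at_Htilde(2)[OF s b u]) simp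
    finally show ?thesis by (simp add: mult.assoc)
  qed
  obtain u where u: "u \<in> Htilde s" "u b = 0"
    "\<And>v. v \<in> Htilde s \<Longrightarrow> v b = 0 \<Longrightarrow> aform s (sigma_coef b \<sigma>1 (- \<sigma>2) 0) u v = f (refl_at b v)"
  proof (rule riesz_point_zero[OF s b \<sigma>(1), of "- \<sigma>2" "\<lambda>v. f (refl_at b v)" "C\<^sup>2 * (2 * split_const s)"])
    show "0 \<le> C\<^sup>2 * (2 * split_const s)" using split_const_pos[OF s0] by simp
  qed (use \<sigma> bd in \<open>auto simp: refl_at_lin HdualD[OF f] refl_at_Htilde[OF s b]\<close>)
  show ?thesis
  proof (rule that[OF u(1,2)])
    fix v assume v: "v \<in> Htilde s" "v b = 0"
    have r: "refl_at b v \<in> Htilde s" "refl_at b v b = 0"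
      using refl_at_Htilde(1)[OF s b v] v(2) by (auto simp: refl_at_def)
    have rr: "refl_at b (refl_at b v) = v"
      by (rule refl_at_refl_at[where v = v and b = b, OF b HtildeD(2)[OF v(1)] v(2)])
    show "aform s (sigma_coef b \<sigma>1 \<sigma>2 0) u v = f v"
      using aform_refl_at[where v = "refl_at b v", OF HtildeD(2)[OF r(1)], of s b \<sigma>1 \<sigma>2 u] u(3)[OF r]
      unfolding rr by simp
  qed
qed

text \<open>Tested with its own reflection, \<open>u\<close> yields the positive form at
  \<open>(u, u)\<close>, and coercivity applies.\<close>

lemma unique_point_zero:
  assumes s: "1/2 < s" "s < 1" and b: "0 < b" "b < 1" and \<sigma>: "0 < \<sigma>1" "\<sigma>2 < 0"
    and u: "u \<in> Htilde s" "u b = 0"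
    and z: "\<And>v. v \<in> Htilde s \<Longrightarrow> v b = 0 \<Longrightarrow> aform s (sigma_coef b \<sigma>1 \<sigma>2 0) u v = 0"
  shows "u = (\<lambda>x. 0)"
proof (rule ccontr)
  assume "u \<noteq> (\<lambda>x. 0)"
  hence "0 < Hnorm2 s u" using Hnorm_pos[OF s u(1)] by (simp add: Hnorm_def)
  moreover have "aform s (sigma_coef b \<sigma>1 \<sigma>2 0) u (refl_at b u) = 0"
    using refl_at_Htilde(1)[OF s b u] u(2) by (intro z) (auto simp: refl_at_def)
  hence "aform s (sigma_coef b \<sigma>1 (- \<sigma>2) 0) u u = 0"
    using aform_refl_at[where v = u, OF HtildeD(2)[OF u(1)]] by simp
  ultimately show False
    using sigma_coef_coercive[OF s b \<sigma>(1), of "- \<sigma>2" u] u \<sigma> by (simp add: mult_le_0_iff)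
qed

lemma fredholm_sigma_coef:
  assumes s: "1/2 < s" "s < 1" and b: "0 < b" "b < 1" and \<sigma>: "0 < \<sigma>1" "\<sigma>2 < 0"
    and \<psi>: "\<psi> \<in> Htilde s" "\<psi> b = 1"
  shows "fredholm_index_zero s (Aop s (sigma_coef b \<sigma>1 \<sigma>2 0))"
proof -
  have s0: "0 < s" using s by simp
  define a where "a = aform s (sigma_coef b \<sigma>1 \<sigma>2 0)"
  define M where "M = \<bar>\<sigma>1\<bar> + \<bar>\<sigma>2\<bar> + \<bar>0::real\<bar>"
  define A where "A = Aop s (sigma_coef b \<sigma>1 \<sigma>2 0)"
  define H where "H = Htilde s"
  define Ker where "Ker = {u \<in> H. A u = (\<lambda>v. 0)}"
  have cb: "coef_bound (sigma_coef b \<sigma>1 \<sigma>2 0) M"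
    unfolding M_def by (rule coef_bound_sigma_coef)
  have A_eq: "A u v = (if v \<in> H then a u v else 0)" for u v
    by (simp add: A_def Aop_def a_def H_def)
  have a_add: "a (\<lambda>x. u x + w x) v = a u v + a w v" if "u \<in> H" "w \<in> H" "v \<in> H" for u v w
    using that unfolding a_def H_def by (rule aform_add_left[OF cb])
  have a_add_right: "a v (\<lambda>x. u x + w x) = a v u + a v w" if "u \<in> H" "w \<in> H" "v \<in> H" for u v w
    using that unfolding a_def H_def by (rule aform_add_right[OF cb])
  have a_diff: "a (\<lambda>x. u x - w x) v = a u v - a w v" if "u \<in> H" "w \<in> H" "v \<in> H" for u v w
    using that unfolding a_def H_def by (rule aform_diff_left[OF cb])
  have a_scale: "a (\<lambda>x. c * u x) v = c * a u v" "a v (\<lambda>x. c * u x) = c * a v u" for c u v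
    by (simp_all add: a_def aform_scale_left aform_scale_right)
  have a_sym: "a u v = a v u" for u v unfolding a_def by (rule aform_commute)
  have AH: "A u \<in> Hdual s" if "u \<in> H" for u
    using that unfolding A_def H_def by (rule Aop_Hdual[OF s cb])
  have Hc: "(\<lambda>x. u x - c * v x) \<in> H" "(\<lambda>x. u x + c * v x) \<in> H" if "u \<in> H" "v \<in> H" for u v c
    using that by (auto simp: H_def intro: Htilde_diff Htilde_add Htilde_scale)
  have \<psi>H: "\<psi> \<in> H" using \<psi> by (simp add: H_def)
  have \<psi>0: "\<psi> \<noteq> (\<lambda>x. 0)" using \<psi>(2) by auto
  \<comment> \<open>\<open>z\<close> acts on the hyperplane as \<open>\<psi>\<close> does, so
    \<open>\<psi> - z\<close> pairs to zero with it and keeps the value 1 at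
    \<open>b\<close>.\<close>
  obtain z where z: "z \<in> H" "z b = 0" "\<And>v. v \<in> H \<Longrightarrow> v b = 0 \<Longrightarrow> a z v = a \<psi> v"
    using solve_point_zero[OF s b \<sigma> AH[OF \<psi>H]] unfolding a_def[symmetric] H_def[symmetric] A_eq by metis
  define k where "k = (\<lambda>x. \<psi> x - z x)"
  have k: "k \<in> H" "k b = 1" using Hc(1)[OF \<psi>H z(1), of 1] z(2) \<psi>(2) by (auto simp: k_def)
  have ak: "a k v = 0" if "v \<in> H" "v b = 0" for v
    using a_diff[OF \<psi>H z(1) that(1)] z(3)[OF that] by (simp add: k_def)
  have dec: "\<exists>v0\<in>H. v0 b = 0 \<and> v = (\<lambda>x. v0 x + v b * k x)" if "v \<in> H" for v
    using Hc(1)[OF that k(1), of "v b"] k(2) by (intro bexI[of _ "\<lambda>x. v x - v b * k x"]) auto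
  define D where "D = a k k"
  \<comment> \<open>Only the component of \<open>v\<close> along \<open>k\<close> is seen by
    \<open>k\<close>. By symmetry \<open>a u k = u b * D\<close>, the scalar equation that remains
    once the problem on the hyperplane is solved.\<close>
  have akv: "a k v = v b * D" if v: "v \<in> H" for v
  proof -
    obtain v0 where "v0 \<in> H" "v0 b = 0" "v = (\<lambda>x. v0 x + v b * k x)" using dec[OF v] by blast
    moreover have "(\<lambda>x. v b * k x) \<in> H" using k(1) by (simp add: H_def Htilde_scale)
    ultimately have "a k v = a k v0 + v b * a k k"
      using a_add_right[of v0 "\<lambda>x. v b * k x" k] k(1) a_scale by metis
    thus ?thesis using ak \<open>v0 \<in> H\<close> \<open>v0 b = 0\<close> by (simp add: D_def)
  qed
  \<comment> \<open>For \<open>u\<close> in the kernel, \<open>u - u b * k\<close> lies in the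
    hyperplane and pairs to zero with it, hence vanishes by uniqueness. Testing with
    \<open>k\<close> then gives \<open>u b * D = 0\<close>.\<close>
  have ker_sub: "u = (\<lambda>x. u b * k x) \<and> (u b \<noteq> 0 \<longrightarrow> D = 0)" if "u \<in> Ker" for u
  proof -
    have u: "u \<in> H" "a u v = 0" if "v \<in> H" for v
      using \<open>u \<in> Ker\<close> that A_eq[of u v] by (auto simp: Ker_def)
    define u0 where "u0 = (\<lambda>x. u x - u b * k x)"
    have uH: "u \<in> H" using u k by blast
    have kc: "(\<lambda>x. u b * k x) \<in> H" using k(1) by (simp add: H_def Htilde_scale)
    have "u0 = (\<lambda>x. 0)"
    proof (rule unique_point_zero[OF s b \<sigma>])
      show "u0 \<in> Htilde s" "u0 b = 0" using Hc(1)[OF uH k(1)] k(2) by (auto simp: u0_def H_def)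
      show "aform s (sigma_coef b \<sigma>1 \<sigma>2 0) u0 v = 0" if "v \<in> Htilde s" "v b = 0" for v
        using that a_diff[OF uH kc, of v] u(2)[of v] ak[of v] a_scale(1)[of "u b" k v]
        by (simp add: u0_def a_def H_def)
    qed
    from fun_cong[OF this] have eq0: "u x - u b * k x = 0" for x unfolding u0_def .
    have eq: "u = (\<lambda>x. u b * k x)" by (rule ext, rule eq_iff_diff_eq_0[THEN iffD2, OF eq0])
    have "u b * D = 0" using akv[OF uH] a_sym[of u k] u(2)[OF k(1)] by simp
    thus ?thesis by (intro conjI eq) auto
  qed
  have range_iff: "f \<in> A ` H \<longleftrightarrow> (D = 0 \<longrightarrow> f k = 0)" if f: "f \<in> Hdual s" for f
  proof
    assume "f \<in> A ` H"
    then obtain u where "u \<in> H" "f = A u" by auto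
    thus "D = 0 \<longrightarrow> f k = 0" using akv[of u] k(1) a_sym[of u k] by (auto simp: A_eq)
  next
    assume D: "D = 0 \<longrightarrow> f k = 0"
    obtain u where u: "u \<in> H" "u b = 0" "\<And>v. v \<in> H \<Longrightarrow> v b = 0 \<Longrightarrow> a u v = f v"
      using solve_point_zero[OF s b \<sigma> f] unfolding a_def[symmetric] H_def[symmetric] by metis
    \<comment> \<open>Since \<open>a u k = 0\<close>, the multiple of \<open>k\<close> settles the
      equation tested with \<open>k\<close> and leaves those on the hyperplane intact. For
      \<open>D = 0\<close> the division convention makes the coefficient 0, which is right because
      then \<open>f k = 0\<close>.\<close>
    define w where "w = (\<lambda>x. u x + f k / D * k x)"
    have wH: "w \<in> H" unfolding w_def by (rule Hc(2)[OF u(1) k(1)])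
    have kc: "(\<lambda>x. c * k x) \<in> H" for c using k(1) by (simp add: H_def Htilde_scale)
    have aw: "a w v = a u v + f k / D * a k v" if "v \<in> H" for v
      unfolding w_def using a_add[OF u(1) kc that] a_scale(1) by metis
    have "A w v = f v" for v
    proof (cases "v \<in> H")
      case True
      obtain v0 where v0: "v0 \<in> H" "v0 b = 0" "v = (\<lambda>x. v0 x + v b * k x)" using dec[OF True] by blast
      have "f (\<lambda>x. v0 x + v b * k x) = f v0 + v b * f k"
        using HdualD[OF f] v0(1) k(1) kc unfolding H_def by metis
      moreover have "a u (\<lambda>x. v0 x + v b * k x) = a u v0 + v b * a u k"
        using a_add_right[OF v0(1) kc u(1)] a_scale(2) by metis
      ultimately have "f v = f v0 + v b * f k" "a u v = a u v0 + v b * a u k"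
        unfolding v0(3)[symmetric] by auto
      moreover have "a u k = 0" using akv[OF u(1)] u(2) a_sym[of u k] by simp
      ultimately show ?thesis
        using aw[OF True] akv[OF True] u(3)[OF v0(1,2)] D True by (cases "D = 0") (auto simp: A_eq)
    qed (use HdualD(1)[OF f] in \<open>auto simp: A_eq H_def\<close>)
    thus "f \<in> A ` H" using wH by (auto intro!: image_eqI[of _ _ w])
  qed
  have lin: "A (\<lambda>x. u x + w x) = (\<lambda>v. A u v + A w v)" "A (\<lambda>x. c * u x) = (\<lambda>v. c * A u v)"
    if "u \<in> H" "w \<in> H" for u w c
    using a_add[OF that] by (auto simp: A_eq a_scale)
  have "dual_norm s (A u) \<le> M * Hnorm s u" if "u \<in> H" for u
    using abs_aform_le_Hnorm[OF s cb, of u] that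
    by (intro dual_norm_le[OF s \<psi>(1) \<psi>0]) (auto simp: A_eq a_def H_def)
  hence bd: "\<exists>C. \<forall>u\<in>H. dual_norm s (A u) \<le> C * Hnorm s u" by blast
  \<comment> \<open>The range is either the whole dual or the annihilator of \<open>k\<close>, and
    evaluation of functionals at \<open>k\<close> is continuous in the dual norm.\<close>
  have closed: "g \<in> A ` H"
    if f: "\<And>n. f n \<in> A ` H" and g: "g \<in> Hdual s"
      and lim: "(\<lambda>n. dual_norm s (\<lambda>v. f n v - g v)) \<longlonglongrightarrow> 0"
    for f :: "nat \<Rightarrow> (real \<Rightarrow> real) \<Rightarrow> real" and g
  proof -
    have fd: "f n \<in> Hdual s" for n using f[of n] AH by auto
    have "g k = 0" if D: "D = 0"
    proof -
      have "\<bar>g k\<bar> \<le> dual_norm s (\<lambda>v. f n v - g v) * Hnorm s k" for n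
        using abs_le_dual_norm[OF Hdual_diff[OF fd g s0 s(2)] s, of k n] k(1) range_iff[OF fd] f D
        by (simp add: H_def)
      moreover have "(\<lambda>n. dual_norm s (\<lambda>v. f n v - g v) * Hnorm s k) \<longlonglongrightarrow> 0"
        using tendsto_mult_left_zero[OF lim] .
      ultimately have "\<bar>g k\<bar> \<le> 0" by (intro LIMSEQ_le_const) auto
      thus ?thesis by simp
    qed
    thus ?thesis using range_iff[OF g] by blast
  qed
  \<comment> \<open>Evaluation at \<open>b\<close> takes the value 1 at \<open>k\<close>; for
    \<open>D = 0\<close> it therefore spans a complement of the range.\<close>
  define ev where "ev v = (if v \<in> H then v b else 0)" for v :: "real \<Rightarrow> real"
  have evd: "ev \<in> Hdual s"
    using abs_point_value_le_Hnorm[OF s, of _ b]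
    by (intro HdualI[where C = "sqrt (point_const s)"]) (auto simp: ev_def H_def Htilde_add Htilde_scale)
  have index: "\<exists>n::nat.
         (\<exists>e::nat \<Rightarrow> real \<Rightarrow> real.
            (\<forall>i<n. e i \<in> Ker) \<and>
            (\<forall>c. (\<lambda>x. \<Sum>i<n. c i * e i x) = (\<lambda>x. 0) \<longrightarrow> (\<forall>i<n. c i = 0)) \<and>
            (\<forall>u\<in>Ker. \<exists>c. u = (\<lambda>x. \<Sum>i<n. c i * e i x))) \<and>
         (\<exists>g::nat \<Rightarrow> (real \<Rightarrow> real) \<Rightarrow> real.
            (\<forall>i<n. g i \<in> Hdual s) \<and>
            (\<forall>c. (\<lambda>v. \<Sum>i<n. c i * g i v) \<in> A ` H \<longrightarrow> (\<forall>i<n. c i = 0)) \<and>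
            (\<forall>f\<in>Hdual s. \<exists>c. \<exists>r\<in>A ` H. f = (\<lambda>v. r v + (\<Sum>i<n. c i * g i v))))"
  proof (cases "D = 0")
    case False
    have "u = (\<lambda>x. 0)" if "u \<in> Ker" for u
      using ker_sub[OF that] False by (metis mult_zero_left)
    moreover have "f \<in> A ` H" if "f \<in> Hdual s" for f using range_iff[OF that] False by blast
    ultimately show ?thesis by (intro exI[of _ 0]) auto
  next
    case True
    have kK: "k \<in> Ker" using akv k(1) True by (auto simp: Ker_def A_eq)
    have "c = 0" if "(\<lambda>v. c * ev v) \<in> A ` H" for c
      using range_iff[OF Hdual_scale[OF evd s0 s(2), of c]] that True k by (simp add: ev_def)
    moreover have "\<exists>c. \<exists>r\<in>A ` H. f = (\<lambda>v. r v + c * ev v)" if f: "f \<in> Hdual s" for f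
    proof -
      have "(\<lambda>v. f v - f k * ev v) \<in> A ` H"
        using range_iff[OF Hdual_diff[OF f Hdual_scale[OF evd s0 s(2), of "f k"] s0 s(2)]] k
        by (simp add: ev_def)
      thus ?thesis by (intro exI[of _ "f k"] bexI[of _ "\<lambda>v. f v - f k * ev v"]) auto
    qed
    moreover have "c = 0" if "(\<lambda>x. c * k x) = (\<lambda>x. 0)" for c
      using fun_cong[OF that, of b] k(2) by simp
    moreover have "\<exists>c. u = (\<lambda>x. c * k x)" if "u \<in> Ker" for u using ker_sub[OF that] by blast
    \<comment> \<open>Bases in the definition carry coefficient sequences; for \<open>n = 1\<close>
      only \<open>c 0\<close> enters, so the scalars are recast as sequences.\<close>
    ultimately have "(\<forall>u\<in>Ker. \<exists>c::nat \<Rightarrow> real. u = (\<lambda>x. c 0 * k x))"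
        "\<forall>f\<in>Hdual s. \<exists>c::nat \<Rightarrow> real. \<exists>r\<in>A ` H. f = (\<lambda>v. r v + c 0 * ev v)"
        "\<forall>c::nat \<Rightarrow> real. (\<lambda>v. c 0 * ev v) \<in> A ` H \<longrightarrow> c 0 = 0"
        "\<forall>c::nat \<Rightarrow> real. (\<lambda>x. c 0 * k x) = (\<lambda>x. 0) \<longrightarrow> c 0 = 0"
      by (metis (full_types))+
    thus ?thesis
      using kK evd by (intro exI[of _ "1::nat"] conjI exI[of _ "\<lambda>_. k"] exI[of _ "\<lambda>_. ev"]) simp_all
  qed
  show ?thesis
    unfolding fredholm_index_zero_def Let_def
    unfolding A_def[symmetric] H_def[symmetric] Ker_def[symmetric]
    using AH lin bd closed index by (intro conjI) blast+
qed

section \<open>Weak T-coercivity\<close>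

text \<open>By rank one, Bolzano-Weierstrass for the bounded reals \<open>v n b\<close> already
  gives a convergent subsequence of the images.\<close>

lemma compact_op_point_value:
  assumes s: "1/2 < s" "s < 1" and \<psi>: "\<psi> \<in> Htilde s"
  shows "compact_op s (\<lambda>v x. v b * \<psi> x)"
  unfolding compact_op_def bounded_op_def
proof (intro conjI allI impI ballI)
  fix v assume "v \<in> Htilde s"
  show "(\<lambda>x. v b * \<psi> x) \<in> Htilde s" using \<psi> by (rule Htilde_scale)
next
  show "lin_on (Htilde s) (\<lambda>v x. v b * \<psi> x)"
    by (auto simp: lin_on_def algebra_simps)
next
  have s0: "0 < s" using s by simp
  have "\<bar>v b\<bar> * Hnorm s \<psi> \<le> sqrt (point_const s) * Hnorm s \<psi> * Hnorm s v" if "v \<in> Htilde s" for v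
    using mult_right_mono[OF abs_point_value_le_Hnorm[OF s that, of b] Hnorm_nonneg[OF s0 s(2), of \<psi>]]
    by (simp add: mult_ac)
  thus "\<exists>C. \<forall>v\<in>Htilde s. Hnorm s (\<lambda>x. v b * \<psi> x) \<le> C * Hnorm s v"
    unfolding Hnorm_scale by blast
next
  fix v :: "nat \<Rightarrow> real \<Rightarrow> real"
  assume "(\<forall>n. v n \<in> Htilde s) \<and> (\<exists>M. \<forall>n. Hnorm s (v n) \<le> M)"
  then obtain M where v: "\<And>n. v n \<in> Htilde s" "\<And>n. Hnorm s (v n) \<le> M" by blast
  have "\<bar>v n b\<bar> \<le> sqrt (point_const s) * M" for n
  proof -
    have "0 \<le> point_const s" using s by (intro point_const_nonneg) auto
    hence "sqrt (point_const s) * Hnorm s (v n) \<le> sqrt (point_const s) * M"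
      using v(2)[of n] by (intro mult_left_mono) auto
    thus ?thesis using abs_point_value_le_Hnorm[OF s v(1)[of n], of b] by linarith
  qed
  hence "bounded (range (\<lambda>n. v n b))"
    unfolding bounded_iff by auto
  then obtain l r where r: "strict_mono r" "((\<lambda>n. v n b) \<circ> r) \<longlonglongrightarrow> l"
    using bounded_imp_convergent_subsequence by blast
  have "(\<lambda>n. v (r n) b - l) \<longlonglongrightarrow> 0"
    using r(2) by (simp add: o_def LIM_zero_iff)
  hence "(\<lambda>n. \<bar>v (r n) b - l\<bar> * Hnorm s \<psi>) \<longlonglongrightarrow> 0"
    by (intro tendsto_mult_left_zero tendsto_rabs_zero)
  hence "(\<lambda>n. Hnorm s (\<lambda>x. v (r n) b * \<psi> x - l * \<psi> x)) \<longlonglongrightarrow> 0"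
    by (simp add: Hnorm_scale flip: left_diff_distrib)
  thus "\<exists>r w. strict_mono r \<and> w \<in> Htilde s \<and> (\<lambda>n. Hnorm s (\<lambda>x. v (r n) b * \<psi> x - w x)) \<longlonglongrightarrow> 0"
    using r(1) Htilde_scale[OF \<psi>] by blast
qed

section \<open>The operator \<open>Top\<close> and the coercivity estimate\<close>

lemma Top_eq: "Top b \<epsilon> \<psi> v = (\<lambda>x. refl_at b (\<lambda>x. v x - v b * \<psi> x) x + \<epsilon> * v b * \<psi> x)"
  by (simp add: Top_def refl_at_def)

lemma Htilde_subtract_point_value:
  fixes b :: real
  assumes s: "0 < s" "s < 1" and \<psi>: "\<psi> \<in> Htilde s" and v: "v \<in> Htilde s"
  defines "v0 \<equiv> (\<lambda>x. v x - v b * \<psi> x)"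
  shows "v0 \<in> Htilde s"
    "Hnorm2 s v0 \<le> 2 * Hnorm2 s v + 2 * (v b)\<^sup>2 * Hnorm2 s \<psi>"
    "Hnorm2 s v \<le> 2 * Hnorm2 s v0 + 2 * (v b)\<^sup>2 * Hnorm2 s \<psi>"
proof -
  show H: "v0 \<in> Htilde s" unfolding v0_def by (intro Htilde_diff Htilde_scale v \<psi>)
  show "Hnorm2 s v0 \<le> 2 * Hnorm2 s v + 2 * (v b)\<^sup>2 * Hnorm2 s \<psi>"
    using Hnorm2_add_le[OF s v Htilde_scale[OF \<psi>], of "- v b"]
    unfolding Hnorm2_scale by (simp add: v0_def)
  show "Hnorm2 s v \<le> 2 * Hnorm2 s v0 + 2 * (v b)\<^sup>2 * Hnorm2 s \<psi>"
    using Hnorm2_add_le[OF s H Htilde_scale[OF \<psi>], of "v b"]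
    unfolding Hnorm2_scale by (simp add: v0_def)
qed

lemma Top_Htilde:
  assumes s: "1/2 < s" "s < 1" and b: "0 < b" "b < 1"
    and \<psi>: "\<psi> \<in> Htilde s" "\<psi> b = 1" and v: "v \<in> Htilde s"
  shows "Top b \<epsilon> \<psi> v \<in> Htilde s"
  unfolding Top_eq using \<psi>(2) s
  by (intro Htilde_add Htilde_scale \<psi>(1) refl_at_Htilde(1)[OF s b] Htilde_subtract_point_value(1) v) auto

text \<open>\<open>Top\<close> reflects the part vanishing at \<open>b\<close> and multiplies the
  \<open>\<psi>\<close> part by \<open>\<epsilon>\<close>; both are involutions. It follows that
  \<open>Top\<close> is bijective and its own inverse.\<close>

lemma Top_involution:
  assumes s: "1/2 < s" "s < 1" and b: "0 < b" "b < 1" and \<epsilon>: "\<epsilon> * \<epsilon> = 1"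
    and \<psi>: "\<psi> \<in> Htilde s" "\<psi> b = 1" and v: "v \<in> Htilde s"
  shows "Top b \<epsilon> \<psi> (Top b \<epsilon> \<psi> v) = v"
proof -
  define v0 where "v0 = (\<lambda>x. v x - v b * \<psi> x)"
  have d: "v0 \<in> Htilde s" "v0 b = 0"
    unfolding v0_def using Htilde_subtract_point_value(1)[OF _ s(2) \<psi>(1) v] s \<psi>(2) by auto
  have T: "Top b \<epsilon> \<psi> v = (\<lambda>x. refl_at b v0 x + \<epsilon> * v b * \<psi> x)" by (simp add: Top_eq v0_def)
  have Tb: "Top b \<epsilon> \<psi> v b = \<epsilon> * v b" using d(2) \<psi>(2) by (simp add: T refl_at_def)
  have "(\<lambda>x. Top b \<epsilon> \<psi> v x - Top b \<epsilon> \<psi> v b * \<psi> x) = refl_at b v0"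
    by (simp only: Tb) (simp add: T)
  hence "Top b \<epsilon> \<psi> (Top b \<epsilon> \<psi> v) = (\<lambda>x. refl_at b (refl_at b v0) x + \<epsilon> * (\<epsilon> * v b) * \<psi> x)"
    by (subst Top_eq) (simp only: Tb)
  also have "refl_at b (refl_at b v0) = v0"
    by (rule refl_at_refl_at[where v = v0 and b = b, OF b HtildeD(2)[OF d(1)] d(2)])
  finally show ?thesis using \<epsilon> by (simp add: v0_def flip: mult.assoc)
qed

lemma bounded_op_Top:
  assumes s: "1/2 < s" "s < 1" and b: "0 < b" "b < 1" and \<epsilon>: "\<epsilon> * \<epsilon> = 1"
    and \<psi>: "\<psi> \<in> Htilde s" "\<psi> b = 1"
  shows "bounded_op s (Top b \<epsilon> \<psi>)"
  unfolding bounded_op_def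
proof (intro conjI ballI)
  show "Top b \<epsilon> \<psi> v \<in> Htilde s" if "v \<in> Htilde s" for v
    by (rule Top_Htilde[OF s b \<psi> that])
  show "lin_on (Htilde s) (Top b \<epsilon> \<psi>)"
    by (auto simp: lin_on_def Top_def algebra_simps)
  have s0: "0 < s" using s by simp
  define S where "S = split_const s"
  define p where "p = Hnorm2 s \<psi>"
  define P where "P = point_const s"
  have pos: "0 \<le> S" "0 \<le> p" "0 \<le> P"
    using split_const_pos[OF s0] Hnorm2_nonneg[OF s0 s(2)] point_const_nonneg[OF s0 s(2)]
    by (auto simp: S_def p_def P_def less_imp_le)
  \<comment> \<open>The first summand bounds the reflected part: 2 from the parallelogram bound,
    \<open>2 * S\<close> from reflection, \<open>2 + 2 * P * p\<close> from passing from
    \<open>v\<close> to \<open>v0\<close>. The second bounds the part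
    \<open>\<epsilon> * v b * \<psi>\<close>.\<close>
  define Q where "Q = 4 * S * (2 + 2 * P * p) + 2 * P * p"
  have "Hnorm s (Top b \<epsilon> \<psi> v) \<le> sqrt Q * Hnorm s v" if v: "v \<in> Htilde s" for v
  proof -
    define v0 where "v0 = (\<lambda>x. v x - v b * \<psi> x)"
    note d = Htilde_subtract_point_value[OF s0 s(2) \<psi>(1) v, of b, folded v0_def]
    have d0: "v0 b = 0" using \<psi>(2) by (simp add: v0_def)
    have r: "refl_at b v0 \<in> Htilde s" "Hnorm2 s (refl_at b v0) \<le> 2 * S * Hnorm2 s v0"
      unfolding S_def by (intro refl_at_Htilde[OF s b] d d0)+
    define N where "N = Hnorm2 s v"
    have vb: "(v b)\<^sup>2 * p \<le> P * N * p"
      unfolding P_def N_def by (intro mult_right_mono point_value_le_Hnorm2[OF s v] pos)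
    have "Hnorm2 s (Top b \<epsilon> \<psi> v) \<le> 2 * Hnorm2 s (refl_at b v0) + 2 * ((\<epsilon> * v b)\<^sup>2 * p)"
      using Hnorm2_add_le[OF s0 s(2) r(1) Htilde_scale[OF \<psi>(1)], of "\<epsilon> * v b"]
      by (simp add: Top_eq v0_def Hnorm2_scale p_def)
    also have "(\<epsilon> * v b)\<^sup>2 = (v b)\<^sup>2" using \<epsilon> by (simp add: power_mult_distrib power2_eq_square)
    finally have 1: "Hnorm2 s (Top b \<epsilon> \<psi> v) \<le> 2 * Hnorm2 s (refl_at b v0) + 2 * ((v b)\<^sup>2 * p)" .
    have "Hnorm2 s v0 \<le> 2 * N + 2 * (P * N * p)"
      using d(2) vb by (simp add: N_def p_def mult.assoc)
    hence "2 * S * Hnorm2 s v0 \<le> 2 * S * (2 * N + 2 * (P * N * p))"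
      using pos by (intro mult_left_mono) auto
    hence "Hnorm2 s (Top b \<epsilon> \<psi> v) \<le> Q * N"
      using 1 r(2) vb by (simp add: Q_def algebra_simps)
    thus ?thesis by (simp add: Hnorm_def N_def flip: real_sqrt_mult)
  qed
  thus "\<exists>C. \<forall>v\<in>Htilde s. Hnorm s (Top b \<epsilon> \<psi> v) \<le> C * Hnorm s v" by blast
qed

text \<open>The form itself, not just its absolute value, is bounded from below. The sign
  \<open>\<epsilon>\<close> multiplies only terms that are estimated in absolute value, so both
  signs are covered.\<close>

lemma weakly_T_coercive:
  assumes s: "1/2 < s" "s < 1" and b: "0 < b" "b < 1" and \<sigma>: "0 < \<sigma>1" "\<sigma>2 < 0"
    and \<psi>: "\<psi> \<in> Htilde s" "\<psi> b = 1" and \<epsilon>: "\<bar>\<epsilon>\<bar> = 1"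
  obtains \<alpha> \<beta> where "0 < \<alpha>" "0 < \<beta>"
    "\<And>v. v \<in> Htilde s \<Longrightarrow> \<alpha> * Hnorm2 s v - \<beta> * Hnorm2 s (\<lambda>x. v b * \<psi> x)
       \<le> \<bar>aform s (sigma_coef b \<sigma>1 \<sigma>2 0) v (Top b \<epsilon> \<psi> v)\<bar>"
proof -
  have s0: "0 < s" using s by simp
  define a where "a = aform s (sigma_coef b \<sigma>1 \<sigma>2 0)"
  define B where "B = aform s (sigma_coef b \<sigma>1 (- \<sigma>2) 0)"
  define M where "M = \<bar>\<sigma>1\<bar> + \<bar>\<sigma>2\<bar> + \<bar>0::real\<bar>"
  define g where "g = min \<sigma>1 (- \<sigma>2) / split_const s"
  have M: "0 < M" using \<sigma> by (simp add: M_def)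
  have g: "0 < g" using \<sigma> split_const_pos[OF s0] by (simp add: g_def)
  have ca: "coef_bound (sigma_coef b \<sigma>1 \<sigma>2 0) M"
    unfolding M_def by (rule coef_bound_sigma_coef)
  have cB: "coef_bound (sigma_coef b \<sigma>1 (- \<sigma>2) 0) M"
    using coef_bound_sigma_coef[of b \<sigma>1 "- \<sigma>2" 0] by (simp add: M_def)
  define p where "p = Hnorm s \<psi>"
  \<comment> \<open>\<open>2 * M^2 / g\<close> comes from Young's inequality for the two mixed
    terms, which costs half of \<open>g\<close>, and \<open>M\<close> from the term in
    \<open>\<psi>\<close> alone; \<open>g / 2\<close> makes up for passing from \<open>v0\<close>
    back to \<open>v\<close>, which halves the leading constant again to
    \<open>g / 4\<close>.\<close>
  define \<beta> where "\<beta> = g / 2 + 2 * M\<^sup>2 / g + M"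
  have "g / 4 * Hnorm2 s v - \<beta> * Hnorm2 s (\<lambda>x. v b * \<psi> x) \<le> \<bar>a v (Top b \<epsilon> \<psi> v)\<bar>"
    if v: "v \<in> Htilde s" for v
  proof -
    define v0 where "v0 = (\<lambda>x. v x - v b * \<psi> x)"
    note d = Htilde_subtract_point_value[OF s0 s(2) \<psi>(1) v, of b, folded v0_def]
    have d0: "v0 b = 0" using \<psi>(2) by (simp add: v0_def)
    define c where "c = v b"
    define n where "n = Hnorm s v0"
    have c\<psi>: "(\<lambda>x. c * \<psi> x) \<in> Htilde s" using \<psi>(1) by (rule Htilde_scale)
    have r: "refl_at b v0 \<in> Htilde s" by (intro refl_at_Htilde(1)[OF s b] d d0)
    have ve: "v = (\<lambda>x. v0 x + c * \<psi> x)" by (simp add: v0_def c_def)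
    have "a v (Top b \<epsilon> \<psi> v) = a v (\<lambda>x. refl_at b v0 x + (\<epsilon> * c) * \<psi> x)"
      by (simp add: Top_eq v0_def c_def)
    also have "\<dots> = a v (refl_at b v0) + \<epsilon> * c * a v \<psi>"
      unfolding a_def using aform_add_right[OF ca r Htilde_scale[OF \<psi>(1)] v]
      by (simp add: aform_scale_right)
    \<comment> \<open>Only the second argument is reflected, so the positive form appears with the
      full \<open>v\<close>; the \<open>\<psi>\<close> part of \<open>v\<close> leaves the mixed
      term \<open>c * B \<psi> v0\<close>.\<close>
    also have "a v (refl_at b v0) = B v v0"
      unfolding a_def B_def by (rule aform_refl_at[OF HtildeD(2)[OF d(1)]])
    also have "B v v0 = B v0 v0 + c * B \<psi> v0"
      unfolding B_def using aform_add_left[OF cB d(1) c\<psi> d(1)]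
      by (simp add: ve[symmetric] aform_scale_left)
    also have "a v \<psi> = a v0 \<psi> + c * a \<psi> \<psi>"
      unfolding a_def using aform_add_left[OF ca d(1) c\<psi> \<psi>(1)]
      by (simp add: ve[symmetric] aform_scale_left)
    finally have e: "a v (Top b \<epsilon> \<psi> v) = B v0 v0 + c * B \<psi> v0 + \<epsilon> * c * (a v0 \<psi> + c * a \<psi> \<psi>)" .
    have n2: "n\<^sup>2 = Hnorm2 s v0" "p\<^sup>2 = Hnorm2 s \<psi>"
      unfolding n_def p_def using s0 s(2) by (simp_all add: Hnorm_square)
    have t1: "g * n\<^sup>2 \<le> B v0 v0"
      using sigma_coef_coercive[OF s b \<sigma>(1), of "- \<sigma>2" v0] \<sigma> d d0 split_const_pos[OF s0]
      by (simp add: n2 B_def g_def field_simps)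
    have t2: "\<bar>c * B \<psi> v0\<bar> \<le> \<bar>c\<bar> * (M * p * n)"
      unfolding abs_mult B_def p_def n_def
      by (intro mult_left_mono abs_aform_le_Hnorm[OF s cB] \<psi> d) simp
    have t3: "\<bar>\<epsilon> * c * a v0 \<psi>\<bar> \<le> \<bar>c\<bar> * (M * n * p)"
      unfolding abs_mult \<epsilon> mult_1 a_def p_def n_def
      by (intro mult_left_mono abs_aform_le_Hnorm[OF s ca] \<psi> d) simp
    have t4: "\<bar>\<epsilon> * c * (c * a \<psi> \<psi>)\<bar> \<le> \<bar>c\<bar> * (\<bar>c\<bar> * (M * p * p))"
      unfolding abs_mult \<epsilon> mult_1 a_def p_def
      by (intro mult_left_mono abs_aform_le_Hnorm[OF s ca] \<psi>) simp_all
    define q where "q = \<bar>c\<bar> * p"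
    have "g * n\<^sup>2 - 2 * M * q * n - M * q\<^sup>2 \<le> a v (Top b \<epsilon> \<psi> v)"
    proof -
      have E: "\<bar>c\<bar> * (M * p * n) = M * q * n" "\<bar>c\<bar> * (M * n * p) = M * q * n"
          "\<bar>c\<bar> * (\<bar>c\<bar> * (M * p * p)) = M * q\<^sup>2"
        by (simp_all add: q_def power2_eq_square mult_ac)
      from t2 t3 t4 have "- (M * q * n) \<le> c * B \<psi> v0" "- (M * q * n) \<le> \<epsilon> * c * a v0 \<psi>"
          "- (M * q\<^sup>2) \<le> \<epsilon> * c * (c * a \<psi> \<psi>)"
        unfolding E by linarith+
      thus ?thesis unfolding e distrib_left using t1 by linarith
    qed
    moreover have "2 * M * q * n \<le> g / 2 * n\<^sup>2 + 2 * M\<^sup>2 / g * q\<^sup>2"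
    proof -
      have "0 \<le> (g * n - 2 * M * q)\<^sup>2 / (2 * g)" using g by simp
      also have "\<dots> = g / 2 * n\<^sup>2 + 2 * M\<^sup>2 / g * q\<^sup>2 - 2 * M * q * n"
        using g by (simp add: power2_eq_square field_simps)
      finally show ?thesis by simp
    qed
    ultimately have l: "g / 2 * n\<^sup>2 - (2 * M\<^sup>2 / g + M) * q\<^sup>2 \<le> a v (Top b \<epsilon> \<psi> v)"
      by (simp add: algebra_simps)
    have q2: "q\<^sup>2 = Hnorm2 s (\<lambda>x. v b * \<psi> x)"
      by (simp add: q_def power_mult_distrib n2 c_def Hnorm2_scale)
    have "Hnorm2 s v \<le> 2 * n\<^sup>2 + 2 * q\<^sup>2"
      using d(3) by (simp add: q2 n2 Hnorm2_scale)
    hence "g / 4 * Hnorm2 s v \<le> g / 4 * (2 * n\<^sup>2 + 2 * q\<^sup>2)"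
      using g by (intro mult_left_mono) auto
    hence "g / 4 * Hnorm2 s v - \<beta> * q\<^sup>2 \<le> a v (Top b \<epsilon> \<psi> v)"
      using l by (simp add: \<beta>_def algebra_simps)
    thus ?thesis unfolding q2 by linarith
  qed
  moreover have "0 < \<beta>" using M g by (simp add: \<beta>_def add_pos_pos)
  ultimately show ?thesis using that[of "g / 4" \<beta>] g by (simp add: a_def)
qed

theorem theorem2p5:
  fixes s b \<sigma>1 \<sigma>2 \<sigma>3 :: real and \<psi> :: "real \<Rightarrow> real"
  assumes hs: "1/2 < s" "s < 1"
    and hb: "0 < b" "b < 1"
    and hsig: "\<sigma>1 > 0" "\<sigma>2 < 0" "\<sigma>3 = 0"
    and hpsi: "\<psi> \<in> Htilde s" "\<psi> b = 1"
    and hcrit: "\<bar>\<sigma>2\<bar> / \<sigma>1 \<noteq> Phi s (I1 b) \<psi> / Phi s (I2 b) \<psi>"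
  shows "let \<epsilon> = sgn (1 - \<bar>\<sigma>2\<bar> / \<sigma>1 * (Phi s (I2 b) \<psi> / Phi s (I1 b) \<psi>));
             T = Top b \<epsilon> \<psi>;
             \<sigma> = sigma_coef b \<sigma>1 \<sigma>2 \<sigma>3
         in bounded_op s T \<and> bij_betw T (Htilde s) (Htilde s) \<and>
            (\<exists>K \<alpha> \<beta>. compact_op s K \<and> \<alpha> > 0 \<and> \<beta> > 0 \<and>
               (\<forall>v\<in>Htilde s. \<bar>aform s \<sigma> v (T v)\<bar> \<ge> \<alpha> * Hnorm2 s v - \<beta> * Hnorm2 s (K v))) \<and>
            fredholm_index_zero s (Aop s \<sigma>)"
proof -
  define \<epsilon> where "\<epsilon> = sgn (1 - \<bar>\<sigma>2\<bar> / \<sigma>1 * (Phi s (I2 b) \<psi> / Phi s (I1 b) \<psi>))"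
  have "1 - \<bar>\<sigma>2\<bar> / \<sigma>1 * (Phi s (I2 b) \<psi> / Phi s (I1 b) \<psi>) \<noteq> 0"
    \<comment> \<open>If one of the two Phi vanishes, division by zero makes the left-hand side 1.\<close>
    using hcrit by (cases "Phi s (I1 b) \<psi> = 0"; cases "Phi s (I2 b) \<psi> = 0") (auto simp: field_simps)
  hence \<epsilon>: "\<bar>\<epsilon>\<bar> = 1" "\<epsilon> * \<epsilon> = 1" by (auto simp: \<epsilon>_def sgn_if)
  have bij: "bij_betw (Top b \<epsilon> \<psi>) (Htilde s) (Htilde s)"
    using Top_involution[OF hs hb \<epsilon>(2) hpsi] Top_Htilde[OF hs hb hpsi]
    by (intro bij_betw_byWitness[where f' = "Top b \<epsilon> \<psi>"]) auto
  obtain \<alpha> \<beta> where "0 < \<alpha>" "0 < \<beta>"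
    "\<And>v. v \<in> Htilde s \<Longrightarrow> \<alpha> * Hnorm2 s v - \<beta> * Hnorm2 s (\<lambda>x. v b * \<psi> x)
       \<le> \<bar>aform s (sigma_coef b \<sigma>1 \<sigma>2 0) v (Top b \<epsilon> \<psi> v)\<bar>"
    using weakly_T_coercive[OF hs hb hsig(1,2) hpsi \<epsilon>(1)] by blast
  hence "\<exists>K \<alpha> \<beta>. compact_op s K \<and> \<alpha> > 0 \<and> \<beta> > 0 \<and>
      (\<forall>v\<in>Htilde s. \<bar>aform s (sigma_coef b \<sigma>1 \<sigma>2 0) v (Top b \<epsilon> \<psi> v)\<bar> \<ge> \<alpha> * Hnorm2 s v - \<beta> * Hnorm2 s (K v))"
    using compact_op_point_value[OF hs hpsi(1), of b]
    by (intro exI[of _ "\<lambda>v x. v b * \<psi> x"] exI[of _ \<alpha>] exI[of _ \<beta>]) auto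
  with bounded_op_Top[OF hs hb \<epsilon>(2) hpsi] bij fredholm_sigma_coef[OF hs hb hsig(1,2) hpsi]
  show ?thesis
    unfolding Let_def \<epsilon>_def[symmetric] hsig(3) by blast
qed

end
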